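(* Let $g$ be the standard metric on the 3-sphere $\mathbb{S}^3$. There exist a smooth function $\varphi:\mathbb{S}^3\to\mathbb{R}$ such that the conformal metric $\bar g=e^{2\varphi}g$ has nonnegative Ricci curvature, and a torus $\mathbb{T}\subset\mathbb{S}^3$ which, with respect to $\bar g$, is a minimal surface of index one and is stable as a constant mean curvature (CMC) surface.
   Context: For a compact orientable surface $\Sigma$ without boundary immersed with constant mean curvature in an orientable Riemannian 3-manifold, with unit normal $N$, second fundamental form $\sigma$, area element $dA$, and Laplacian $\Delta$ (with nonpositive spectrum), let $$Q(u,u)=\int_\Sigma \big(|\nabla u|^2-(|\sigma|^2+\mathrm{Ric}(N))\,u^2\big)\,dA=-\int_\Sigma u\,Lu\,dA,\qquad u\in C^\infty(\Sigma),$$ where $L=\Delta+|\sigma|^2+\mathrm{Ric}(N)$ is the Jacobi operator and $\mathrm{Ric}(N)=\mathrm{Ric}(N,N)$ is the ambient Ricci curvature evaluated on $N$. - $\Sigma$ is stable as a CMC surface if $Q(u,u)\geq 0$ for every $u\in C^\infty(\Sigma)$ with $\int_\Sigma u\,dA=0$. - If $\Sigma$ is minimal (zero mean curvature), its index is the number, counted with multiplicity, of negative eigenvalues of $L$ (that is, of real numbers $\lambda<0$ for which $Lu+\lambda u=0$ has a nonzero solution $u$). *)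

theory Defs
  imports "HOL-Analysis.Analysis" "HOL-Library.Function_Algebras"
begin

section \<open>Smooth maps\<close>

primrec Ck_on :: "nat \<Rightarrow> 'a::real_normed_vector set \<Rightarrow> ('a \<Rightarrow> 'b::real_normed_vector) \<Rightarrow> bool" where
  "Ck_on 0 S f \<longleftrightarrow> continuous_on S f"
| "Ck_on (Suc k) S f \<longleftrightarrow>
     (\<forall>x\<in>S. f differentiable (at x)) \<and> (\<forall>v. Ck_on k S (\<lambda>x. frechet_derivative f (at x) v))"

text \<open>Only used for open \<^term>\<open>S\<close>.\<close>
definition smooth_on :: "'a::real_normed_vector set \<Rightarrow> ('a \<Rightarrow> 'b::real_normed_vector) \<Rightarrow> bool" where
  "smooth_on S f \<longleftrightarrow> (\<forall>k. Ck_on k S f)"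

text \<open>Smoothness on the submanifold $S^3$ of $R^4$: restriction of a smooth function defined
  on a neighbourhood.\<close>
definition smooth_on_S3 :: "(real^4 \<Rightarrow> real) \<Rightarrow> bool" where
  "smooth_on_S3 \<phi> \<longleftrightarrow> (\<exists>W \<psi>. open W \<and> sphere 0 1 \<subseteq> W \<and> smooth_on W \<psi> \<and> (\<forall>p\<in>sphere 0 1. \<psi> p = \<phi> p))"

definition partial :: "'n::finite \<Rightarrow> (real^'n \<Rightarrow> 'b::real_normed_vector) \<Rightarrow> real^'n \<Rightarrow> 'b" where
  "partial i f x = frechet_derivative f (at x) (axis i 1)"


section \<open>Riemannian geometry in local coordinates\<close>

text \<open>A metric in coordinates is the matrix-valued function $x \mapsto (G_{ij}(x))$.\<close>

definition christoffel :: "(real^'n \<Rightarrow> real^'n^'n) \<Rightarrow> 'n::finite \<Rightarrow> 'n \<Rightarrow> 'n \<Rightarrow> real^'n \<Rightarrow> real" where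
  "christoffel G k i j x =
     (1/2) * (\<Sum>l\<in>UNIV. matrix_inv (G x) $ k $ l *
        (partial i (\<lambda>y. G y $ j $ l) x + partial j (\<lambda>y. G y $ i $ l) x - partial l (\<lambda>y. G y $ i $ j) x))"

text \<open>Component $l$ of $R(\partial_i,\partial_j)\partial_k$, where
  $R(X,Y)Z = \nabla_X\nabla_Y Z - \nabla_Y\nabla_X Z - \nabla_{[X,Y]}Z$.\<close>
definition riemann :: "(real^'n \<Rightarrow> real^'n^'n) \<Rightarrow> 'n::finite \<Rightarrow> 'n \<Rightarrow> 'n \<Rightarrow> 'n \<Rightarrow> real^'n \<Rightarrow> real" where
  "riemann G l i j k x =
     partial i (christoffel G l j k) x - partial j (christoffel G l i k) x
     + (\<Sum>m\<in>UNIV. christoffel G l i m x * christoffel G m j k x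
                 - christoffel G l j m x * christoffel G m i k x)"

text \<open>$\mathrm{Ric}(Y,Z) = \mathrm{tr}(X \mapsto R(X,Y)Z)$.\<close>
definition ricci :: "(real^'n \<Rightarrow> real^'n^'n) \<Rightarrow> 'n::finite \<Rightarrow> 'n \<Rightarrow> real^'n \<Rightarrow> real" where
  "ricci G j k x = (\<Sum>i\<in>UNIV. riemann G i i j k x)"

definition laplace_beltrami :: "(real^'n \<Rightarrow> real^'n^'n) \<Rightarrow> (real^'n \<Rightarrow> real) \<Rightarrow> real^'n::finite \<Rightarrow> real" where
  "laplace_beltrami h u x =
     (1 / sqrt (det (h x))) *
     (\<Sum>i\<in>UNIV. partial i (\<lambda>y. sqrt (det (h y)) * (\<Sum>j\<in>UNIV. matrix_inv (h y) $ i $ j * partial j u y)) x)"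

definition grad_norm_sq :: "(real^'n \<Rightarrow> real^'n^'n) \<Rightarrow> (real^'n \<Rightarrow> real) \<Rightarrow> real^'n::finite \<Rightarrow> real" where
  "grad_norm_sq h u x = (\<Sum>i\<in>UNIV. \<Sum>j\<in>UNIV. matrix_inv (h x) $ i $ j * partial i u x * partial j u x)"


section \<open>The 3-sphere\<close>

text \<open>Left multiplication of the unit quaternion \<^term>\<open>p\<close> by $i$, $j$, $k$ gives an orthonormal
  basis of the tangent space $p^\perp$.\<close>
definition frame :: "real^4 \<Rightarrow> 3 \<Rightarrow> real^4" where
  "frame p k =
     (if k = 1 then vector [- p$2, p$1, - p$4, p$3]
      else if k = 2 then vector [- p$3, p$4, p$1, - p$2]
      else vector [- p$4, - p$3, p$2, p$1])"

text \<open>Stereographic projection from \<^term>\<open>- p\<close> and its inverse. The resulting chart is centred at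
  \<^term>\<open>p\<close>: it maps \<^term>\<open>p\<close> to 0. Tensors at \<^term>\<open>p\<close> are computed in this chart; as they are
  tensors, the choice of the chart is immaterial.\<close>
definition stereo :: "real^4 \<Rightarrow> real^4 \<Rightarrow> real^3" where
  "stereo p q = (\<chi> k. (q \<bullet> frame p k) / (1 + q \<bullet> p))"

definition stereo_inv :: "real^4 \<Rightarrow> real^3 \<Rightarrow> real^4" where
  "stereo_inv p y =
     (1 / (1 + y \<bullet> y)) *\<^sub>R ((1 - y \<bullet> y) *\<^sub>R p + 2 *\<^sub>R (\<Sum>k\<in>UNIV. (y $ k) *\<^sub>R frame p k))"

lemma vector_4 [simp]:
  "(vector [a, b, c, d] :: ('a::zero)^4) $ 1 = a"
  "(vector [a, b, c, d] :: ('a::zero)^4) $ 2 = b"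
  "(vector [a, b, c, d] :: ('a::zero)^4) $ 3 = c"
  "(vector [a, b, c, d] :: ('a::zero)^4) $ 4 = d"
  by (simp_all add: vector_def)

lemma frame_orthogonal: "frame p k \<bullet> p = 0"
  by (simp add: frame_def inner_vec_def sum_4 algebra_simps)

lemma frame_orthonormal:
  assumes "p \<in> sphere 0 1"
  shows "frame p k \<bullet> frame p l = (if k = l then 1 else 0)"
proof -
  have "p \<bullet> p = 1" using assms by (simp add: dot_square_norm)
  then have "p$1 * p$1 + p$2 * p$2 + p$3 * p$3 + p$4 * p$4 = 1"
    by (simp add: inner_vec_def sum_4)
  then show ?thesis
    using exhaust_3[of k] exhaust_3[of l]
    by (auto simp: frame_def inner_vec_def sum_4 algebra_simps)
qed

lemma stereo_inv_0: "stereo_inv p 0 = p"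
  by (simp add: stereo_inv_def)

lemma stereo_inv_inner:
  assumes "p \<in> sphere 0 1"
  shows "stereo_inv p y \<bullet> p = (1 - y \<bullet> y) / (1 + y \<bullet> y)"
    and "stereo_inv p y \<bullet> frame p l = 2 * y $ l / (1 + y \<bullet> y)"
proof -
  have pp: "p \<bullet> p = 1" using assms by (simp add: dot_square_norm)
  show "stereo_inv p y \<bullet> p = (1 - y \<bullet> y) / (1 + y \<bullet> y)"
    by (simp add: stereo_inv_def inner_add_left inner_sum_left frame_orthogonal pp)
  have "(\<Sum>k\<in>UNIV. y $ k * (frame p k \<bullet> frame p l)) = y $ l"
    by (simp add: frame_orthonormal[OF assms] if_distrib cong: if_cong)
  then show "stereo_inv p y \<bullet> frame p l = 2 * y $ l / (1 + y \<bullet> y)"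
    by (simp add: stereo_inv_def inner_add_left inner_sum_left inner_commute[of p]
        frame_orthogonal)
qed

lemma stereo_stereo_inv:
  assumes "p \<in> sphere 0 1"
  shows "stereo p (stereo_inv p y) = y"
proof -
  have pos: "1 + y \<bullet> y > 0" by (simp add: add_pos_nonneg)
  then have "1 + (1 - y \<bullet> y) / (1 + y \<bullet> y) = 2 / (1 + y \<bullet> y)" by (simp add: field_simps)
  then show ?thesis
    using pos by (simp add: stereo_def stereo_inv_inner[OF assms] vec_eq_iff)
qed

lemma stereo_inv_in_sphere:
  assumes "p \<in> sphere 0 1"
  shows "stereo_inv p y \<in> sphere 0 1"
proof -
  let ?q = "stereo_inv p y" and ?s = "y \<bullet> y"
  have pos: "1 + ?s > 0" by (simp add: add_pos_nonneg)
  have "?q \<bullet> ?q = (1 / (1 + ?s)) * ((1 - ?s) * (?q \<bullet> p) + 2 * (\<Sum>k\<in>UNIV. y $ k * (?q \<bullet> frame p k)))"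
    by (subst (2) stereo_inv_def) (simp add: inner_add_right inner_sum_right)
  also have "(\<Sum>k\<in>UNIV. y $ k * (?q \<bullet> frame p k)) = (\<Sum>k\<in>UNIV. y $ k * (2 * y $ k / (1 + ?s)))"
    by (simp only: stereo_inv_inner[OF assms])
  also have "\<dots> = 2 * (\<Sum>k\<in>UNIV. y $ k * y $ k) / (1 + ?s)"
    by (simp add: sum_distrib_left sum_divide_distrib mult_ac)
  also have "(\<Sum>k\<in>UNIV. y $ k * y $ k) = ?s"
    by (simp add: inner_vec_def)
  also have "(1 / (1 + ?s)) * ((1 - ?s) * (?q \<bullet> p) + 2 * (2 * ?s / (1 + ?s))) = 1"
    using pos by (simp add: stereo_inv_inner[OF assms] divide_simps) (simp add: algebra_simps)
  finally show ?thesis by (simp add: norm_eq_1)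
qed

text \<open>A Riemannian metric on $S^3$ is represented by \<^term>\<open>g\<close> with \<^term>\<open>g p v w\<close> the inner product
  of \<^term>\<open>v\<close>, \<^term>\<open>w\<close> in $T_pS^3 = p^\perp$; other arguments are irrelevant.\<close>
type_synonym metric_S3 = "real^4 \<Rightarrow> real^4 \<Rightarrow> real^4 \<Rightarrow> real"

definition round_metric :: metric_S3 where
  "round_metric p v w = v \<bullet> w"

definition conformal :: "(real^4 \<Rightarrow> real) \<Rightarrow> metric_S3 \<Rightarrow> metric_S3" where
  "conformal \<phi> g p v w = exp (2 * \<phi> p) * g p v w"

definition metric_in_chart :: "metric_S3 \<Rightarrow> real^4 \<Rightarrow> real^3 \<Rightarrow> real^3^3" where
  "metric_in_chart g p y =
     (\<chi> i j. g (stereo_inv p y) (partial i (stereo_inv p) y) (partial j (stereo_inv p) y))"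

text \<open>Components in the chart at \<^term>\<open>p\<close> of a vector tangent to $S^3$ at \<^term>\<open>p\<close>.\<close>
definition components :: "real^4 \<Rightarrow> real^4 \<Rightarrow> real^3" where
  "components p v = frechet_derivative (stereo p) (at p) v"

definition Ric :: "metric_S3 \<Rightarrow> real^4 \<Rightarrow> real^4 \<Rightarrow> real^4 \<Rightarrow> real" where
  "Ric g p v w =
     (\<Sum>j\<in>UNIV. \<Sum>k\<in>UNIV. ricci (metric_in_chart g p) j k 0 * components p v $ j * components p w $ k)"

definition nonneg_Ricci :: "metric_S3 \<Rightarrow> bool" where
  "nonneg_Ricci g \<longleftrightarrow> (\<forall>p\<in>sphere 0 1. \<forall>v. v \<bullet> p = 0 \<longrightarrow> Ric g p v v \<ge> 0)"


section \<open>Tori in the 3-sphere\<close>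

definition doubly_periodic :: "(real^2 \<Rightarrow> 'b) \<Rightarrow> bool" where
  "doubly_periodic f \<longleftrightarrow> (\<forall>x i. f (x + axis i 1) = f x)"

text \<open>A smooth embedding of $R^2/Z^2$ with image \<^term>\<open>T\<close>, lifted to $R^2$.\<close>
definition torus_embedding :: "(real^2 \<Rightarrow> real^4) \<Rightarrow> (real^4) set \<Rightarrow> bool" where
  "torus_embedding F T \<longleftrightarrow>
     smooth_on UNIV F \<and>
     (\<forall>x y. F x = F y \<longleftrightarrow> (\<forall>i. x $ i - y $ i \<in> \<int>)) \<and>
     (\<forall>x. inj (frechet_derivative F (at x))) \<and>
     range F = T \<and> T \<subseteq> sphere 0 1"

definition unit_normal :: "metric_S3 \<Rightarrow> (real^2 \<Rightarrow> real^4) \<Rightarrow> (real^2 \<Rightarrow> real^4) \<Rightarrow> bool" where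
  "unit_normal g F N \<longleftrightarrow>
     smooth_on UNIV N \<and> doubly_periodic N \<and>
     (\<forall>x. N x \<bullet> F x = 0 \<and> (\<forall>i. g (F x) (N x) (partial i F x) = 0) \<and> g (F x) (N x) (N x) = 1)"

text \<open>$C^\infty(T)$, via the parametrization.\<close>
definition torus_functions :: "(real^2 \<Rightarrow> real) set" where
  "torus_functions = {u. smooth_on UNIV u \<and> doubly_periodic u}"

definition first_fundamental :: "metric_S3 \<Rightarrow> (real^2 \<Rightarrow> real^4) \<Rightarrow> real^2 \<Rightarrow> real^2^2" where
  "first_fundamental g F x = (\<chi> i j. g (F x) (partial i F x) (partial j F x))"

text \<open>The covariant derivative $\nabla_{\partial_i F}\,\partial_j F$ of the ambient metric at
  \<^term>\<open>F x\<close>, in the chart centred at \<^term>\<open>F x\<close>.\<close>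
definition covariant_second :: "metric_S3 \<Rightarrow> (real^2 \<Rightarrow> real^4) \<Rightarrow> 2 \<Rightarrow> 2 \<Rightarrow> real^2 \<Rightarrow> real^3" where
  "covariant_second g F i j x =
     (let G = metric_in_chart g (F x); f = (\<lambda>y. stereo (F x) (F y)) in
      partial i (partial j f) x +
      (\<chi> k. \<Sum>a\<in>UNIV. \<Sum>b\<in>UNIV. christoffel G k a b 0 * partial i f x $ a * partial j f x $ b))"

definition second_fundamental ::
    "metric_S3 \<Rightarrow> (real^2 \<Rightarrow> real^4) \<Rightarrow> (real^2 \<Rightarrow> real^4) \<Rightarrow> 2 \<Rightarrow> 2 \<Rightarrow> real^2 \<Rightarrow> real" where
  "second_fundamental g F N i j x =
     (\<Sum>a\<in>UNIV. \<Sum>b\<in>UNIV. metric_in_chart g (F x) 0 $ a $ b *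
        covariant_second g F i j x $ a * components (F x) (N x) $ b)"

definition mean_curvature ::
    "metric_S3 \<Rightarrow> (real^2 \<Rightarrow> real^4) \<Rightarrow> (real^2 \<Rightarrow> real^4) \<Rightarrow> real^2 \<Rightarrow> real" where
  "mean_curvature g F N x =
     (1/2) * (\<Sum>i\<in>UNIV. \<Sum>j\<in>UNIV.
        matrix_inv (first_fundamental g F x) $ i $ j * second_fundamental g F N i j x)"

definition sigma_norm_sq ::
    "metric_S3 \<Rightarrow> (real^2 \<Rightarrow> real^4) \<Rightarrow> (real^2 \<Rightarrow> real^4) \<Rightarrow> real^2 \<Rightarrow> real" where
  "sigma_norm_sq g F N x =
     (let H = matrix_inv (first_fundamental g F x); s = (\<lambda>i j. second_fundamental g F N i j x) in
      \<Sum>i\<in>UNIV. \<Sum>j\<in>UNIV. \<Sum>k\<in>UNIV. \<Sum>l\<in>UNIV. H $ i $ k * H $ j $ l * s i j * s k l)"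

text \<open>Integral against the area element; \<^term>\<open>cbox 0 1\<close> is the unit square, a fundamental domain.\<close>
definition area_integral :: "metric_S3 \<Rightarrow> (real^2 \<Rightarrow> real^4) \<Rightarrow> (real^2 \<Rightarrow> real) \<Rightarrow> real" where
  "area_integral g F u = integral (cbox 0 1) (\<lambda>x. u x * sqrt (det (first_fundamental g F x)))"


section \<open>Stability and index\<close>

definition jacobi_potential ::
    "metric_S3 \<Rightarrow> (real^2 \<Rightarrow> real^4) \<Rightarrow> (real^2 \<Rightarrow> real^4) \<Rightarrow> real^2 \<Rightarrow> real" where
  "jacobi_potential g F N x = sigma_norm_sq g F N x + Ric g (F x) (N x) (N x)"

definition jacobi_operator ::
    "metric_S3 \<Rightarrow> (real^2 \<Rightarrow> real^4) \<Rightarrow> (real^2 \<Rightarrow> real^4) \<Rightarrow> (real^2 \<Rightarrow> real) \<Rightarrow> real^2 \<Rightarrow> real" where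
  "jacobi_operator g F N u x =
     laplace_beltrami (first_fundamental g F) u x + jacobi_potential g F N x * u x"

definition stability_form ::
    "metric_S3 \<Rightarrow> (real^2 \<Rightarrow> real^4) \<Rightarrow> (real^2 \<Rightarrow> real^4) \<Rightarrow> (real^2 \<Rightarrow> real) \<Rightarrow> real" where
  "stability_form g F N u =
     area_integral g F (\<lambda>x. grad_norm_sq (first_fundamental g F) u x - jacobi_potential g F N x * (u x)\<^sup>2)"

definition minimal ::
    "metric_S3 \<Rightarrow> (real^2 \<Rightarrow> real^4) \<Rightarrow> (real^2 \<Rightarrow> real^4) \<Rightarrow> bool" where
  "minimal g F N \<longleftrightarrow> (\<forall>x. mean_curvature g F N x = 0)"

definition cmc ::
    "metric_S3 \<Rightarrow> (real^2 \<Rightarrow> real^4) \<Rightarrow> (real^2 \<Rightarrow> real^4) \<Rightarrow> bool" where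
  "cmc g F N \<longleftrightarrow> (\<exists>c. \<forall>x. mean_curvature g F N x = c)"

definition stable_cmc ::
    "metric_S3 \<Rightarrow> (real^2 \<Rightarrow> real^4) \<Rightarrow> (real^2 \<Rightarrow> real^4) \<Rightarrow> bool" where
  "stable_cmc g F N \<longleftrightarrow>
     cmc g F N \<and>
     (\<forall>u\<in>torus_functions. area_integral g F u = 0 \<longrightarrow> stability_form g F N u \<ge> 0)"

definition eigenspace ::
    "metric_S3 \<Rightarrow> (real^2 \<Rightarrow> real^4) \<Rightarrow> (real^2 \<Rightarrow> real^4) \<Rightarrow> real \<Rightarrow> (real^2 \<Rightarrow> real) set" where
  "eigenspace g F N \<mu> = {u\<in>torus_functions. \<forall>x. jacobi_operator g F N u x + \<mu> * u x = 0}"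

definition negative_eigenvalues ::
    "metric_S3 \<Rightarrow> (real^2 \<Rightarrow> real^4) \<Rightarrow> (real^2 \<Rightarrow> real^4) \<Rightarrow> real set" where
  "negative_eigenvalues g F N = {\<mu>. \<mu> < 0 \<and> (\<exists>u\<in>eigenspace g F N \<mu>. \<exists>x. u x \<noteq> 0)}"

interpretation fun_space: vector_space "\<lambda>(r::real) (f::'a \<Rightarrow> real) x. r * f x"
  by unfold_locales (auto simp: fun_eq_iff algebra_simps)

text \<open>The finiteness conditions exclude that \<^term>\<open>fun_space.dim\<close> or the sum takes its default
  value 0.\<close>
definition has_index ::
    "metric_S3 \<Rightarrow> (real^2 \<Rightarrow> real^4) \<Rightarrow> (real^2 \<Rightarrow> real^4) \<Rightarrow> nat \<Rightarrow> bool" where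
  "has_index g F N k \<longleftrightarrow>
     finite (negative_eigenvalues g F N) \<and>
     (\<forall>\<mu>\<in>negative_eigenvalues g F N. \<exists>B. finite B \<and> eigenspace g F N \<mu> \<subseteq> fun_space.span B) \<and>
     (\<Sum>\<mu>\<in>negative_eigenvalues g F N. fun_space.dim (eigenspace g F N \<mu>)) = k"

end

theory Submission
  imports Defs
begin

text \<open>Let $s = |z_1|^2 - |z_2|^2$ on $S^3 \subset C^2$ and take $\varphi = s^2/8$. The torus is the Clifford torus
  $s = 0$, where $\varphi$ and $d\varphi$ vanish. Its first fundamental form is therefore unchanged, it stays minimal and
  $|\sigma|^2 = 2$. The Hessian of $\varphi$ is just large enough in the normal direction to make $\mathrm{Ric}(N) = 0$
  on the torus, while $\mathrm{Ric} \ge 0$ everywhere, so the Jacobi operator is $\Delta + 2$. As the first positive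
  eigenvalue of the Laplacian on the Clifford torus equals 2, which is Wirtinger's inequality on the square torus, the only
  negative direction is that of the constants.\<close>

section \<open>Smooth maps and partial derivatives\<close>

text \<open>For the round metric the potential on the Clifford torus is |\<sigma>|^2 + Ric(N) = 2 +
  2 = 4, while the Laplacian has the eigenvalue 2 with multiplicity four, attained by the restricted
  coordinates of R^4. So the round torus has index five and is unstable even for functions of mean
  zero; this is why the metric has to change. There is no margin in the change. If both fundamental
  forms are kept, summing the stability form over the four coordinates, whose squares add up to 1,
  gives minus the integral of Ric(N). Hence Ric \<ge> 0 and stability force Ric(N) = 0 along the
  whole torus, and for \<phi> = f(s) with f'(0) = 0 this fixes f''(0) = 1/4. The delicate point is
  then Ric \<ge> 0 off the torus: the Ricci form is degenerate at s = 0, so the estimate near it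
  must be exact to first order in s. The curvature is expressed through Euclidean derivatives of a
  polynomial extension of \<phi> to R^4, in the stereographic chart where the metric is a multiple
  of the identity matrix.\<close>

lemma smooth_on_UNIV_class:
  assumes "f \<in> C"
    and diff: "\<And>f x. f \<in> C \<Longrightarrow> f differentiable (at x)"
    and closed: "\<And>f v. f \<in> C \<Longrightarrow> (\<lambda>x. frechet_derivative f (at x) v) \<in> C"
  shows "smooth_on UNIV f"
proof -
  \<comment> \<open>The induction runs over all members of \<open>C\<close> at once, because its
    step passes from \<open>f\<close> to directional derivatives of \<open>f\<close>. No formula for
    higher derivatives is required, only a class that contains them.\<close>
  have "Ck_on k UNIV f" if "f \<in> C" for k f
    using that
  proof (induction k arbitrary: f)
    case 0
    then show ?case
      by (auto intro!: continuous_at_imp_continuous_on differentiable_imp_continuous_within diff)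
  next
    case (Suc k)
    then show ?case by (auto intro: diff closed)
  qed
  then show ?thesis using assms(1) by (auto simp: smooth_on_def)
qed

text \<open>The direction \<open>v\<close> is fixed in the polynomial claim because
  \<open>Ck_on\<close> differentiates along one fixed vector at a time.\<close>

lemma polynomial_directional_derivative:
  fixes f :: "'a::euclidean_space \<Rightarrow> real"
  assumes "real_polynomial_function f"
  shows "\<exists>f'. (\<forall>x. (f has_derivative f' x) (at x)) \<and> (\<forall>v. real_polynomial_function (\<lambda>x. f' x v))"
  using assms
proof (induction f rule: real_polynomial_function.induct)
  case (linear f)
  then show ?case
    by (intro exI[of _ "\<lambda>x. f"])
      (auto intro: bounded_linear_imp_has_derivative real_polynomial_function.intros(2))
next
  case (const c)
  then show ?case
    by (intro exI[of _ "\<lambda>x v. 0"]) (auto intro: real_polynomial_function.intros(2))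
next
  case (add f g)
  then obtain f' g' where "\<forall>x. (f has_derivative f' x) (at x)" "\<forall>v. real_polynomial_function (\<lambda>x. f' x v)"
    "\<forall>x. (g has_derivative g' x) (at x)" "\<forall>v. real_polynomial_function (\<lambda>x. g' x v)" by blast
  then show ?case
    by (intro exI[of _ "\<lambda>x v. f' x v + g' x v"])
      (auto intro: has_derivative_add real_polynomial_function.intros(3))
next
  case (mult f g)
  then obtain f' g' where "\<forall>x. (f has_derivative f' x) (at x)" "\<forall>v. real_polynomial_function (\<lambda>x. f' x v)"
    "\<forall>x. (g has_derivative g' x) (at x)" "\<forall>v. real_polynomial_function (\<lambda>x. g' x v)" by blast
  then show ?case using mult.hyps
    by (intro exI[of _ "\<lambda>x v. f x * g' x v + f' x v * g x"] conjI allI has_derivative_mult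
        real_polynomial_function.intros(3,4)) auto
qed

lemma smooth_on_polynomial:
  fixes f :: "'a::euclidean_space \<Rightarrow> real"
  assumes "real_polynomial_function f"
  shows "smooth_on UNIV f"
proof (rule smooth_on_UNIV_class[of _ "Collect real_polynomial_function"])
  fix f :: "'a \<Rightarrow> real" and x v
  assume "f \<in> Collect real_polynomial_function"
  then obtain f' where f': "\<forall>x. (f has_derivative f' x) (at x)" "\<forall>v. real_polynomial_function (\<lambda>x. f' x v)"
    using polynomial_directional_derivative by blast
  show "f differentiable (at x)" using f' by (auto simp: differentiable_def)
  have "(\<lambda>x. frechet_derivative f (at x) v) = (\<lambda>x. f' x v)"
    using f' frechet_derivative_at by metis
  then show "(\<lambda>x. frechet_derivative f (at x) v) \<in> Collect real_polynomial_function"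
    using f' by simp
qed (use assms in simp)

lemma smooth_on_const: "smooth_on UNIV (\<lambda>x. c)"
  by (rule smooth_on_UNIV_class[of _ "range (\<lambda>c x. c)"]) (auto simp: frechet_derivative_const)

lemma smooth_on_differentiable: "smooth_on UNIV u \<Longrightarrow> u differentiable (at x)"
  unfolding smooth_on_def by (metis Ck_on.simps(2) UNIV_I)

lemma smooth_on_partial: "smooth_on UNIV u \<Longrightarrow> smooth_on UNIV (partial i u)"
  unfolding smooth_on_def partial_def[abs_def] by (metis Ck_on.simps(2))

lemma smooth_on_continuous: "smooth_on UNIV u \<Longrightarrow> continuous_on UNIV u"
  unfolding smooth_on_def by (metis Ck_on.simps(1))

lemma frechet_derivative_periodic:
  fixes u :: "'a::real_normed_vector \<Rightarrow> 'b::real_normed_vector"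
  assumes "\<And>x. u (x + a) = u x"
  shows "frechet_derivative u (at (x + a)) = frechet_derivative u (at x)"
proof -
  have shift: "(u has_derivative f) (at x)" if "\<And>x. u (x + b) = u x" and "(u has_derivative f) (at (x + b))" for f and x b :: 'a
  proof -
    have "((\<lambda>x. x + b) has_derivative (\<lambda>v. v)) (at x)" by (auto intro!: derivative_eq_intros)
    from has_derivative_compose[OF this that(2)] show ?thesis by (simp add: that(1))
  qed
  have "u (x + - a) = u x" for x using assms[of "x - a"] by simp
  \<comment> \<open>Both points admit the same derivatives, so the choice behind
    \<open>frechet_derivative\<close> agrees, also where there is no derivative.\<close>
  from shift[where b = "- a" and x = "x + a", OF this]
  have "(u has_derivative f) (at (x + a)) \<longleftrightarrow> (u has_derivative f) (at x)" for f
    using shift[OF assms] by auto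
  then show ?thesis by (simp add: frechet_derivative_def)
qed

lemma doubly_periodic_partial: "doubly_periodic u \<Longrightarrow> doubly_periodic (partial i u)"
  unfolding doubly_periodic_def partial_def by (metis frechet_derivative_periodic)

lemma partial_eqI: "(f has_derivative f') (at x) \<Longrightarrow> partial i f x = f' (axis i 1)"
  unfolding partial_def by (simp add: frechet_derivative_at[symmetric])

lemma partial_diff_const:
  fixes u :: "real^'n::finite \<Rightarrow> real"
  assumes "\<And>x. u differentiable (at x)"
  shows "partial i (\<lambda>x. u x - c) = partial i u"
proof
  fix x
  have "(u has_derivative frechet_derivative u (at x)) (at x)"
    using assms frechet_derivative_works by blast
  from partial_eqI[OF has_derivative_diff[OF this has_derivative_const[of c]]]
  show "partial i (\<lambda>x. u x - c) x = partial i u x" by (simp add: partial_def)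
qed

section \<open>The Clifford torus\<close>

text \<open>Vector coefficients make this family closed under directional derivatives:
  differentiation only permutes and rescales \<open>A\<close>, \<open>B\<close>, \<open>C\<close>,
  \<open>D\<close>. One derivative formula thus serves the torus, its normal and all their
  derivatives. The factor 2 pi gives period 1 in each variable.\<close>

definition trig_map :: "'b \<Rightarrow> 'b \<Rightarrow> 'b \<Rightarrow> 'b \<Rightarrow> real^2 \<Rightarrow> 'b::real_normed_vector" where
  "trig_map A B C D x =
     cos (2 * pi * x $ 1) *\<^sub>R A + sin (2 * pi * x $ 1) *\<^sub>R B +
     cos (2 * pi * x $ 2) *\<^sub>R C + sin (2 * pi * x $ 2) *\<^sub>R D"

lemma has_derivative_trig_map:
  "(trig_map A B C D has_derivative
     (\<lambda>v. trig_map ((2 * pi * v $ 1) *\<^sub>R B) (- (2 * pi * v $ 1) *\<^sub>R A)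
                   ((2 * pi * v $ 2) *\<^sub>R D) (- (2 * pi * v $ 2) *\<^sub>R C) x)) (at x)"
  unfolding trig_map_def
  by (rule derivative_eq_intros bounded_linear_imp_has_derivative bounded_linear_vec_nth refl)+
    (auto simp: fun_eq_iff mult_ac)

lemma frechet_trig_map:
  "frechet_derivative (trig_map A B C D) (at x) v =
     trig_map ((2 * pi * v $ 1) *\<^sub>R B) (- (2 * pi * v $ 1) *\<^sub>R A)
              ((2 * pi * v $ 2) *\<^sub>R D) (- (2 * pi * v $ 2) *\<^sub>R C) x"
  by (subst frechet_derivative_at[OF has_derivative_trig_map, symmetric]) simp

lemma smooth_on_trig_map: "smooth_on UNIV (trig_map A B C D)"
proof (rule smooth_on_UNIV_class[of _ "{trig_map A B C D |A B C D. True}"])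
  fix f :: "real^2 \<Rightarrow> 'a" and x v
  assume "f \<in> {trig_map A B C D |A B C D. True}"
  then obtain A B C D where f: "f = trig_map A B C D" by blast
  show "f differentiable (at x)" unfolding f differentiable_def
    using has_derivative_trig_map by blast
  show "(\<lambda>x. frechet_derivative f (at x) v) \<in> {trig_map A B C D |A B C D. True}"
    unfolding f frechet_trig_map by blast
qed blast

lemma doubly_periodic_trig_map: "doubly_periodic (trig_map A B C D)"
  unfolding doubly_periodic_def
proof (intro allI)
  fix x :: "real^2" and i :: 2
  have per: "cos (2 * pi * (t + 1)) = cos (2 * pi * t)" "sin (2 * pi * (t + 1)) = sin (2 * pi * t)" for t
    by (simp_all add: distrib_left sin_add cos_add)
  show "trig_map A B C D (x + axis i 1) = trig_map A B C D x"
    using exhaust_2[of i] by (auto simp: trig_map_def axis_def per)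
qed

definition clifford :: "real^2 \<Rightarrow> real^4" where
  "clifford = trig_map (axis 1 (1 / sqrt 2)) (axis 2 (1 / sqrt 2)) (axis 3 (1 / sqrt 2)) (axis 4 (1 / sqrt 2))"

text \<open>Half the Euclidean gradient of s at the point \<open>clifford x\<close>; it is tangent
  to the sphere because s = 0 there.\<close>

definition clifford_normal :: "real^2 \<Rightarrow> real^4" where
  "clifford_normal = trig_map (axis 1 (1 / sqrt 2)) (axis 2 (1 / sqrt 2)) (- axis 3 (1 / sqrt 2)) (- axis 4 (1 / sqrt 2))"

lemma trig_map_axis_nth:
  "trig_map (axis 1 a) (axis 2 b) (axis 3 c) (axis (4::4) d) x $ k =
     (if k = 1 then a * cos (2 * pi * x $ 1) else if k = 2 then b * sin (2 * pi * x $ 1)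
      else if k = 3 then c * cos (2 * pi * x $ 2) else d * sin (2 * pi * x $ 2))"
  using exhaust_4[of k] by (auto simp: trig_map_def axis_def)

lemma minus_axis: "- axis k c = axis k (- c::'a::ab_group_add)"
  by (simp add: vec_eq_iff axis_def)

lemmas clifford_nth =
  clifford_def[THEN fun_cong, THEN arg_cong[where f = "\<lambda>v. v $ k" for k], unfolded trig_map_axis_nth]
  clifford_normal_def[unfolded minus_axis, THEN fun_cong, THEN arg_cong[where f = "\<lambda>v. v $ k" for k], unfolded trig_map_axis_nth]

lemma partial_clifford:
  "partial i clifford =
     (if i = 1 then trig_map (axis 2 (2 * pi / sqrt 2)) (axis 1 (- (2 * pi / sqrt 2))) 0 0
      else trig_map 0 0 (axis 4 (2 * pi / sqrt 2)) (axis 3 (- (2 * pi / sqrt 2))))"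
  using exhaust_2[of i]
  by (auto simp: fun_eq_iff partial_def clifford_def frechet_trig_map trig_map_def vec_eq_iff axis_def)

lemma torus_embedding_clifford: "torus_embedding clifford (range clifford)"
  unfolding torus_embedding_def
proof (intro conjI allI)
  show "smooth_on UNIV clifford"
    by (simp add: clifford_def smooth_on_trig_map)
  show "range clifford \<subseteq> sphere 0 1"
  proof clarsimp
    fix x
    have half: "a * a / 2 + b * b / 2 + c * c / 2 + d * d / 2 = 1"
      if "a * a + b * b = 1" "c * c + d * d = 1" for a b c d :: real
      using that by (simp add: field_simps)
    have "clifford x \<bullet> clifford x = 1"
      by (simp add: inner_vec_def sum_4 clifford_nth half)
    then show "norm (clifford x) = 1" by (simp add: norm_eq_1)
  qed
  fix x y
  have "clifford x = clifford y \<longleftrightarrow>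
    (sin (2 * pi * x $ 1) = sin (2 * pi * y $ 1) \<and> cos (2 * pi * x $ 1) = cos (2 * pi * y $ 1)) \<and>
    (sin (2 * pi * x $ 2) = sin (2 * pi * y $ 2) \<and> cos (2 * pi * x $ 2) = cos (2 * pi * y $ 2))"
    by (auto simp: vec_eq_iff forall_4 clifford_nth)
  moreover have "(sin (2 * pi * s) = sin (2 * pi * t) \<and> cos (2 * pi * s) = cos (2 * pi * t)) \<longleftrightarrow> s - t \<in> \<int>" for s t
  proof -
    have "2 * pi * s = 2 * pi * t + 2 * pi * of_int n \<longleftrightarrow> s - t = of_int n" for n
    proof -
      have "2 * pi * s = 2 * pi * t + 2 * pi * of_int n \<longleftrightarrow> 2 * pi * s = 2 * pi * (t + of_int n)"
        by (simp add: distrib_left)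
      also have "\<dots> \<longleftrightarrow> s = t + of_int n" by simp
      finally show ?thesis by auto
    qed
    then show ?thesis unfolding sin_cos_eq_iff by (auto elim: Ints_cases)
  qed
  ultimately show "(clifford x = clifford y) = (\<forall>i. x $ i - y $ i \<in> \<int>)"
    by (simp add: forall_2)
next
  fix x
  have lin: "linear (frechet_derivative clifford (at x))"
    unfolding clifford_def by (intro linear_frechet_derivative) (auto simp: differentiable_def intro: has_derivative_trig_map)
  show "inj (frechet_derivative clifford (at x))"
    unfolding linear_injective_0[OF lin]
  proof (intro allI impI)
    fix v
    assume "frechet_derivative clifford (at x) v = 0"
    then have "v $ 1 * sin (2 * pi * x $ 1) = 0" "v $ 1 * cos (2 * pi * x $ 1) = 0"
      "v $ 2 * sin (2 * pi * x $ 2) = 0" "v $ 2 * cos (2 * pi * x $ 2) = 0"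
      by (auto simp: vec_eq_iff forall_4 clifford_def frechet_trig_map trig_map_def axis_def)
    \<comment> \<open>Sine and cosine have no common zero.\<close>
    then have "v $ 1 = 0" "v $ 2 = 0"
      using sin_zero_abs_cos_one by fastforce+
    then show "v = 0" by (simp add: vec_eq_iff forall_2)
  qed
qed auto

section \<open>Conformally flat metrics\<close>

lemma matrix_inv_mat:
  assumes "c \<noteq> (0::real)"
  shows "matrix_inv (mat c :: real^'n^'n) = mat (inverse c)"
proof -
  have mult: "mat a ** mat b = (mat (a * b) :: real^'n^'n)" for a b :: real
    by (simp add: matrix_matrix_mult_def mat_def vec_eq_iff if_distrib[where f = "\<lambda>x. x * _"] cong: if_cong)
  then have inv: "mat (inverse c) ** mat c = (mat 1 :: real^'n^'n)" "mat c ** mat (inverse c) = (mat 1 :: real^'n^'n)"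
    using assms by simp_all
  \<comment> \<open>\<open>matrix_inv\<close> is a choice; the explicit inverse shows that the
    chosen matrix is a right inverse, and multiplying from the left then identifies it.\<close>
  have "mat c ** matrix_inv (mat c) = (mat 1 :: real^'n^'n)"
    unfolding matrix_inv_def by (rule someI2[of _ "mat (inverse c)"]) (use inv in blast)+
  then have "mat (inverse c) ** (mat c ** matrix_inv (mat c)) = (mat (inverse c) :: real^'n^'n)"
    by simp
  then show ?thesis by (simp add: matrix_mul_assoc inv)
qed

lemma matrix_inv_mat_nth:
  "c \<noteq> (0::real) \<Longrightarrow> matrix_inv (mat c :: real^'n^'n) $ i $ j = (if i = j then inverse c else 0)"
  by (simp add: matrix_inv_mat) (simp add: mat_def)

context
  fixes \<psi> :: "real^3 \<Rightarrow> real" and G :: "real^3 \<Rightarrow> real^3^3" and d\<psi> :: "real^3 \<Rightarrow> real^3"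
  assumes G: "\<And>y. G y = mat (exp (2 * \<psi> y))"
    and d\<psi>: "\<And>y. (\<psi> has_derivative (\<lambda>v. d\<psi> y \<bullet> v)) (at y)"
begin

lemma christoffel_conformally_flat:
  "christoffel G k i j y =
     (if j = k then d\<psi> y $ i else 0) + (if i = k then d\<psi> y $ j else 0) - (if i = j then d\<psi> y $ k else 0)"
proof -
  have "((\<lambda>y. G y $ a $ b) has_derivative (\<lambda>v. if a = b then 2 * exp (2 * \<psi> y) * (d\<psi> y \<bullet> v) else 0)) (at y)" for a b
    by (cases "a = b") (auto simp: G mat_def intro!: derivative_eq_intros d\<psi>)
  from partial_eqI[OF this]
  have p: "partial c (\<lambda>y. G y $ a $ b) y = (if a = b then 2 * exp (2 * \<psi> y) * d\<psi> y $ c else 0)" for a b c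
    by (simp add: inner_axis)
  have m: "matrix_inv (G y) $ k $ l = (if k = l then inverse (exp (2 * \<psi> y)) else 0)" for l
    unfolding G by (subst matrix_inv_mat) (auto simp: mat_def)
  have delta: "(\<Sum>l\<in>UNIV. (if k = l then E else 0) * f l) = E * f k" for E and f :: "3 \<Rightarrow> real"
    by (simp add: if_distrib[where f = "\<lambda>x. x * _"] cong: if_cong)
  have "christoffel G k i j y = inverse (exp (2 * \<psi> y)) / 2 *
     ((if j = k then 2 * exp (2 * \<psi> y) * d\<psi> y $ i else 0) + (if i = k then 2 * exp (2 * \<psi> y) * d\<psi> y $ j else 0)
      - (if i = j then 2 * exp (2 * \<psi> y) * d\<psi> y $ k else 0))"
    unfolding christoffel_def m p delta by simp
  then show ?thesis by (auto simp: distrib_left right_diff_distrib)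
qed

text \<open>This is the case n = 3 of Ric = - (n - 2) (Hess \<psi> - d\<psi> d\<psi>) -
  (\<Delta>\<psi> + (n - 2) |d\<psi>|^2) I for the metric exp(2\<psi>) I. It is checked by expanding
  all indices; the symmetry of the Hessian \<open>H\<close> enters as a hypothesis, which the
  explicit \<phi> satisfies.\<close>

lemma ricci_conformally_flat:
  assumes H: "(d\<psi> has_derivative H) (at x)"
    and sym: "\<And>i j. H (axis i 1) $ j = H (axis j 1) $ i"
  shows "ricci G j k x = - H (axis j 1) $ k + d\<psi> x $ j * d\<psi> x $ k
    - (if j = k then (\<Sum>i\<in>UNIV. H (axis i 1) $ i) + d\<psi> x \<bullet> d\<psi> x else 0)"
proof -
  have Hn: "((\<lambda>y. d\<psi> y $ i) has_derivative (\<lambda>v. H v $ i)) (at x)" for i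
    using H by (rule bounded_linear.has_derivative[OF bounded_linear_vec_nth])
  have If: "((\<lambda>y. if P then d\<psi> y $ i else 0) has_derivative (\<lambda>v. if P then H v $ i else 0)) (at x)" for P i
    by (cases P) (simp_all add: Hn)
  have "((\<lambda>y. (if j = k then d\<psi> y $ i else 0) + (if i = k then d\<psi> y $ j else 0) - (if i = j then d\<psi> y $ k else 0))
    has_derivative (\<lambda>v. (if j = k then H v $ i else 0) + (if i = k then H v $ j else 0) - (if i = j then H v $ k else 0))) (at x)"
    for k i j :: 3
    by (intro has_derivative_add has_derivative_diff If)
  from partial_eqI[OF this]
  have p: "partial l (christoffel G k i j) x = (if j = k then H (axis l 1) $ i else 0)
     + (if i = k then H (axis l 1) $ j else 0) - (if i = j then H (axis l 1) $ k else 0)" for l k i j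
    unfolding christoffel_conformally_flat[abs_def] .
  have jk: "j = 1 \<or> j = 2 \<or> j = 3" "k = 1 \<or> k = 2 \<or> k = 3" by (rule exhaust_3)+
  show ?thesis
    unfolding ricci_def riemann_def p christoffel_conformally_flat sum_3 inner_vec_def
    using jk sym[of 1 2] sym[of 1 3] sym[of 2 3] by (elim disjE; simp add: algebra_simps)
qed

end

section \<open>The stereographic chart\<close>

text \<open>The partial derivative of \<open>stereo_inv p\<close>, with the numerator in the
  quotient rule expressed through \<open>stereo_inv\<close> itself, so that only inner products
  among \<open>p\<close>, \<open>stereo_inv p y\<close> and the frame occur later.\<close>

definition stereo_inv_partial :: "real^4 \<Rightarrow> 3 \<Rightarrow> real^3 \<Rightarrow> real^4" where
  "stereo_inv_partial p i y =
     (2 / (1 + y \<bullet> y)) *\<^sub>R (frame p i - (y $ i) *\<^sub>R (p + stereo_inv p y))"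

lemma one_plus_inner_pos: "1 + (y::'a::real_inner) \<bullet> y > 0"
  by (simp add: add_pos_nonneg)

lemma has_derivative_stereo_inv:
  "(stereo_inv p has_derivative (\<lambda>v. \<Sum>i\<in>UNIV. v $ i *\<^sub>R stereo_inv_partial p i y)) (at y)"
proof -
  have pos: "1 + y \<bullet> y \<noteq> 0" using one_plus_inner_pos[of y] by simp
  have e: "stereo_inv p = (\<lambda>y. inverse (1 + y \<bullet> y) *\<^sub>R ((1 - y \<bullet> y) *\<^sub>R p + 2 *\<^sub>R (\<Sum>k\<in>UNIV. (y $ k) *\<^sub>R frame p k)))"
    by (simp add: stereo_inv_def[abs_def] divide_inverse)
  have "(stereo_inv p has_derivative
     (\<lambda>v. inverse (1 + y \<bullet> y) *\<^sub>R (- (2 * (y \<bullet> v)) *\<^sub>R p + 2 *\<^sub>R (\<Sum>k\<in>UNIV. (v $ k) *\<^sub>R frame p k))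
        + (- (2 * (y \<bullet> v)) * inverse (1 + y \<bullet> y)) *\<^sub>R stereo_inv p y)) (at y)"
    unfolding e
    apply (rule derivative_eq_intros bounded_linear.has_derivative[OF bounded_linear_vec_nth] pos refl)+
    apply (simp add: fun_eq_iff inner_commute algebra_simps)
    done
  moreover have "(\<Sum>i\<in>UNIV. v $ i *\<^sub>R stereo_inv_partial p i y) =
     inverse (1 + y \<bullet> y) *\<^sub>R (- (2 * (y \<bullet> v)) *\<^sub>R p + 2 *\<^sub>R (\<Sum>k\<in>UNIV. (v $ k) *\<^sub>R frame p k))
        + (- (2 * (y \<bullet> v)) * inverse (1 + y \<bullet> y)) *\<^sub>R stereo_inv p y" for v
    unfolding stereo_inv_partial_def sum_3 inner_vec_def
    by (simp add: divide_inverse algebra_simps)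
  ultimately show ?thesis by simp
qed

lemma partial_stereo_inv: "partial i (stereo_inv p) y = stereo_inv_partial p i y"
  using exhaust_3[of i] by (auto simp: partial_eqI[OF has_derivative_stereo_inv] sum_3 axis_def)

text \<open>With q = \<open>stereo_inv p y\<close> and D = \<open>1 + y \<bullet> y\<close>, the
  vector p + q has squared length 4 / D and inner product 2 y_k / D with the k-th frame vector. The
  terms in y_i y_j therefore cancel, leaving the orthonormality of the frame.\<close>

lemma stereo_inv_partial_inner:
  assumes "p \<in> sphere 0 1"
  shows "stereo_inv_partial p i y \<bullet> stereo_inv_partial p j y = (if i = j then 4 / (1 + y \<bullet> y)\<^sup>2 else 0)"
proof -
  have D: "1 + y \<bullet> y \<noteq> 0" using one_plus_inner_pos[of y] by simp
  define q where "q = stereo_inv p y"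
  have pp: "p \<bullet> p = 1" using assms by (simp add: norm_eq_1)
  have qq: "q \<bullet> q = 1" using stereo_inv_in_sphere[OF assms, of y] by (simp add: norm_eq_1 q_def)
  have qp: "q \<bullet> p = 2 / (1 + y \<bullet> y) - 1" "p \<bullet> q = 2 / (1 + y \<bullet> y) - 1"
    using stereo_inv_inner(1)[OF assms, of y] D by (simp_all add: q_def inner_commute field_simps)
  have qf: "q \<bullet> frame p k = 2 * y $ k / (1 + y \<bullet> y)" "frame p k \<bullet> q = 2 * y $ k / (1 + y \<bullet> y)" for k
    using stereo_inv_inner(2)[OF assms, of y k] by (simp_all add: q_def inner_commute)
  have fp: "frame p k \<bullet> p = 0" "p \<bullet> frame p k = 0" for k
    using frame_orthogonal by (simp_all add: inner_commute)
  have "(frame p i - (y $ i) *\<^sub>R (p + q)) \<bullet> (frame p j - (y $ j) *\<^sub>R (p + q)) = (if i = j then 1 else 0)"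
    by (simp add: inner_diff_left inner_diff_right inner_add_left inner_add_right pp qq qp qf fp
        frame_orthonormal[OF assms] algebra_simps)
  then show ?thesis
    by (simp add: stereo_inv_partial_def q_def[symmetric] power2_eq_square)
qed

lemma metric_in_chart_conformal_round:
  assumes "p \<in> sphere 0 1"
  shows "metric_in_chart (conformal \<phi> round_metric) p y =
    mat (exp (2 * (\<phi> (stereo_inv p y) + ln 2 - ln (1 + y \<bullet> y))))"
proof -
  have D: "1 + y \<bullet> y > 0" by (rule one_plus_inner_pos)
  have "exp (2 * (\<phi> (stereo_inv p y) + ln 2 - ln (1 + y \<bullet> y))) =
    exp (2 * \<phi> (stereo_inv p y)) * (exp (ln 2))\<^sup>2 / (exp (ln (1 + y \<bullet> y)))\<^sup>2"
    unfolding exp_double[symmetric] exp_add[symmetric] exp_diff[symmetric] by (simp add: algebra_simps)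
  also have "\<dots> = exp (2 * \<phi> (stereo_inv p y)) * (4 / (1 + y \<bullet> y)\<^sup>2)"
    using D by simp
  finally show ?thesis
    by (simp add: vec_eq_iff metric_in_chart_def conformal_def round_metric_def mat_def
        partial_stereo_inv stereo_inv_partial_inner[OF assms])
qed

text \<open>In the chart, the round part \<^term>\<open>ln 2 - ln (1 + y \<bullet> y)\<close> contributes its Hessian $-2\,I$,
  and the second derivatives of the inverse chart at 0 contribute $-4\,\delta_{ij}\,p$.\<close>
lemma chart_conformal_factor:
  fixes g :: "real^4 \<Rightarrow> real^4"
  assumes p: "p \<in> sphere 0 1"
    and g: "\<And>q. (\<phi> has_derivative (\<lambda>w. g q \<bullet> w)) (at q)"
    and h: "(g has_derivative h) (at p)"
  defines "d\<psi> \<equiv> \<lambda>y. (\<chi> i. g (stereo_inv p y) \<bullet> stereo_inv_partial p i y - 2 * y $ i / (1 + y \<bullet> y))"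
  shows "((\<lambda>y. \<phi> (stereo_inv p y) + ln 2 - ln (1 + y \<bullet> y)) has_derivative (\<lambda>v. d\<psi> y \<bullet> v)) (at y)"
    and "(d\<psi> has_derivative (\<lambda>v. \<chi> i. (\<Sum>j\<in>UNIV. v $ j * (4 * (h (frame p j) \<bullet> frame p i)))
           - (4 * (g p \<bullet> p) + 2) * v $ i)) (at 0)"
    and "d\<psi> 0 $ i = 2 * (g p \<bullet> frame p i)"
proof -
  have D: "1 + y \<bullet> y > 0" for y :: "real^3" by (rule one_plus_inner_pos)
  have "((\<lambda>y. \<phi> (stereo_inv p y) + ln 2 - ln (1 + y \<bullet> y)) has_derivative
      (\<lambda>v. g (stereo_inv p y) \<bullet> (\<Sum>i\<in>UNIV. v $ i *\<^sub>R stereo_inv_partial p i y) - (2 * (y \<bullet> v)) / (1 + y \<bullet> y))) (at y)"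
    by (rule derivative_eq_intros has_derivative_compose[OF has_derivative_stereo_inv g] D refl)+
      (simp add: fun_eq_iff inner_commute divide_inverse algebra_simps)
  then show "((\<lambda>y. \<phi> (stereo_inv p y) + ln 2 - ln (1 + y \<bullet> y)) has_derivative (\<lambda>v. d\<psi> y \<bullet> v)) (at y)"
    by (rule has_derivative_eq_rhs)
      (simp add: d\<psi>_def fun_eq_iff inner_vec_def[of "vec_lambda _"] inner_vec_def[of y] sum_3 inner_add_right
        add_divide_distrib algebra_simps)
  have sp0: "stereo_inv_partial p i 0 = 2 *\<^sub>R frame p i" for i
    by (simp add: stereo_inv_partial_def)
  show "d\<psi> 0 $ i = 2 * (g p \<bullet> frame p i)"
    by (simp add: d\<psi>_def sp0 stereo_inv_0)
  have dsp: "(stereo_inv_partial p i has_derivative (\<lambda>v. - (4 * v $ i) *\<^sub>R p)) (at 0)" for i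
  proof -
    have e: "stereo_inv_partial p i = (\<lambda>y. (2 * inverse (1 + y \<bullet> y)) *\<^sub>R (frame p i - (y $ i) *\<^sub>R (p + stereo_inv p y)))"
      by (simp add: stereo_inv_partial_def[abs_def] divide_inverse)
    have "(stereo_inv_partial p i has_derivative
       (\<lambda>v. 2 *\<^sub>R (- ((v $ i) *\<^sub>R (p + p))))) (at 0)"
      unfolding e
      by (rule derivative_eq_intros bounded_linear.has_derivative[OF bounded_linear_vec_nth]
          has_derivative_stereo_inv refl | simp add: stereo_inv_0)+
    then show ?thesis by (rule has_derivative_eq_rhs) (auto simp: fun_eq_iff scaleR_2[symmetric] scaleR_add_right)
  qed
  have h': "(g has_derivative h) (at (stereo_inv p 0))" using h by (simp add: stereo_inv_0)
  have lin: "linear h" using h has_derivative_linear by blast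
  have dg: "((\<lambda>y. g (stereo_inv p y)) has_derivative (\<lambda>v. \<Sum>j\<in>UNIV. (2 * v $ j) *\<^sub>R h (frame p j))) (at 0)"
    using has_derivative_compose[OF has_derivative_stereo_inv h']
    by (rule has_derivative_eq_rhs)
      (simp add: sp0 linear_sum[OF lin] linear_scale[OF lin] fun_eq_iff mult.commute)
  have comp: "((\<lambda>y. g (stereo_inv p y) \<bullet> stereo_inv_partial p i y - 2 * y $ i * inverse (1 + y \<bullet> y)) has_derivative
     (\<lambda>v. (\<Sum>j\<in>UNIV. v $ j * (4 * (h (frame p j) \<bullet> frame p i))) - (4 * (g p \<bullet> p) + 2) * v $ i)) (at 0)" for i
    by (rule derivative_eq_intros dg dsp bounded_linear.has_derivative[OF bounded_linear_vec_nth] refl | simp)+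
      (auto simp: fun_eq_iff stereo_inv_0 sp0 sum_3 inner_add_left algebra_simps)
  show "(d\<psi> has_derivative (\<lambda>v. \<chi> i. (\<Sum>j\<in>UNIV. v $ j * (4 * (h (frame p j) \<bullet> frame p i)))
           - (4 * (g p \<bullet> p) + 2) * v $ i)) (at 0)"
    unfolding d\<psi>_def divide_inverse using comp
    by (subst has_derivative_componentwise_within) (auto simp: Basis_vec_def inner_axis)
qed

text \<open>Parseval's identity: \<open>p\<close> and the three vectors \<open>frame p k\<close> are
  pairwise orthogonal and all have the length of \<open>p\<close>.\<close>

lemma sum_frame_inner:
  "(\<Sum>k\<in>UNIV. (x \<bullet> frame p k) * (y \<bullet> frame p k)) = (p \<bullet> p) * (x \<bullet> y) - (x \<bullet> p) * (y \<bullet> p)"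
  by (simp add: sum_3 frame_def inner_vec_def sum_4 algebra_simps)

text \<open>The spherical Hessian of \<phi> is the Euclidean one minus
  \<open>g p \<bullet> p\<close> times the metric. In Ric = 2 - (Hess \<phi> - d\<phi> d\<phi>) -
  (\<Delta>\<phi> + |d\<phi>|^2) this correction occurs once in the Hessian and three times in the
  Laplacian, whence \<open>4 * (g p \<bullet> p)\<close> in \<open>\<tau>\<close>. The outer factors
  4 appear because the coordinate vectors at the centre are twice the frame.\<close>

lemma ricci_conformal_round:
  fixes g :: "real^4 \<Rightarrow> real^4"
  assumes p: "p \<in> sphere 0 1"
    and g: "\<And>q. (\<phi> has_derivative (\<lambda>w. g q \<bullet> w)) (at q)"
    and h: "(g has_derivative h) (at p)"
    and sym: "\<And>v w. h v \<bullet> w = h w \<bullet> v"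
  defines "\<tau> \<equiv> 2 + 4 * (g p \<bullet> p) - (\<Sum>i\<in>UNIV. h (frame p i) \<bullet> frame p i + (g p \<bullet> frame p i)\<^sup>2)"
  shows "ricci (metric_in_chart (conformal \<phi> round_metric) p) j k 0 =
    - 4 * (h (frame p j) \<bullet> frame p k) + 4 * (g p \<bullet> frame p j) * (g p \<bullet> frame p k) + (if j = k then 4 * \<tau> else 0)"
proof -
  let ?d = "\<lambda>y. (\<chi> i. g (stereo_inv p y) \<bullet> stereo_inv_partial p i y - 2 * y $ i / (1 + y \<bullet> y))"
  let ?H = "\<lambda>v. (\<chi> i. (\<Sum>j\<in>UNIV. v $ j * (4 * (h (frame p j) \<bullet> frame p i))) - (4 * (g p \<bullet> p) + 2) * v $ i) :: real^3"
  note c = chart_conformal_factor[OF p g h]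
  have H: "?H (axis i 1) $ j = 4 * (h (frame p i) \<bullet> frame p j) - (if i = j then 4 * (g p \<bullet> p) + 2 else 0)" for i j
    using exhaust_3[of i] by (auto simp: sum_3 axis_def)
  have "ricci (metric_in_chart (conformal \<phi> round_metric) p) j k 0 = - ?H (axis j 1) $ k + ?d 0 $ j * ?d 0 $ k
    - (if j = k then (\<Sum>i\<in>UNIV. ?H (axis i 1) $ i) + ?d 0 \<bullet> ?d 0 else 0)"
  proof (rule ricci_conformally_flat[OF metric_in_chart_conformal_round[OF p, of \<phi>] c(1) c(2)])
    show "?H (axis i 1) $ j = ?H (axis j 1) $ i" for i j
      unfolding H using sym[of "frame p i" "frame p j"] by simp
  qed
  then show ?thesis
    unfolding H inner_vec_def[of "?d 0"] c(3) \<tau>_def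
    by (cases "j = k") (simp_all add: sum_3 power2_eq_square algebra_simps)
qed

text \<open>For the same reason \<open>W w\<close> is the tangent vector with chart components
  \<open>w\<close>, which makes the Ricci form free of coordinates.\<close>

lemma ricci_form_conformal_round:
  fixes g :: "real^4 \<Rightarrow> real^4"
  assumes p: "p \<in> sphere 0 1"
    and g: "\<And>q. (\<phi> has_derivative (\<lambda>w. g q \<bullet> w)) (at q)"
    and h: "(g has_derivative h) (at p)"
    and sym: "\<And>v w. h v \<bullet> w = h w \<bullet> v"
  defines "\<tau> \<equiv> 2 + 4 * (g p \<bullet> p) - (\<Sum>i\<in>UNIV. h (frame p i) \<bullet> frame p i + (g p \<bullet> frame p i)\<^sup>2)"
  defines "W \<equiv> \<lambda>w. \<Sum>k\<in>UNIV. (2 * w $ k) *\<^sub>R frame p k"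
  shows "(\<Sum>j\<in>UNIV. \<Sum>k\<in>UNIV. ricci (metric_in_chart (conformal \<phi> round_metric) p) j k 0 * w $ j * w $ k) =
    - (h (W w) \<bullet> W w) + (g p \<bullet> W w)\<^sup>2 + \<tau> * (W w \<bullet> W w)"
proof -
  have lin: "linear h" using h has_derivative_linear by blast
  have WW: "W w \<bullet> W w = 4 * (w \<bullet> w)"
    by (simp add: W_def sum_3 inner_add_left inner_add_right frame_orthonormal[OF p] inner_vec_def[of w])
  show ?thesis
    unfolding ricci_conformal_round[OF p g h sym] \<tau>_def[symmetric] WW
    by (simp add: W_def sum_3 inner_vec_def[of w] linear_add[OF lin] linear_scale[OF lin] inner_add_left inner_add_right
        power2_eq_square algebra_simps)
qed

section \<open>The conformal metric\<close>

text \<open>The symmetric matrix of the quadratic form s: \<open>flip q \<bullet> q\<close> is s and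
  \<open>2 *\<^sub>R flip q\<close> its Euclidean gradient.\<close>

definition flip :: "real^4 \<Rightarrow> real^4" where
  "flip q = vector [q $ 1, q $ 2, - q $ 3, - q $ 4]"

text \<open>For $\varphi = f(s)$ the Ricci curvature of $e^{2\varphi}g$ along the $g$-unit direction of $\nabla s$ is
  $2(1 - 4(1 - s^2)f'' + 6sf')$. It has to be nonnegative and to vanish at $s = 0$, and $f = s^2/8$ does both.\<close>
definition conformal_exponent :: "real^4 \<Rightarrow> real" where
  "conformal_exponent q = (flip q \<bullet> q)\<^sup>2 / 8"

abbreviation conf_metric :: metric_S3 where
  "conf_metric \<equiv> conformal conformal_exponent round_metric"

lemma inner_flip: "flip v \<bullet> w = v $ 1 * w $ 1 + v $ 2 * w $ 2 - v $ 3 * w $ 3 - v $ 4 * w $ 4"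
  by (simp add: flip_def inner_vec_def sum_4)

lemma inner_4: "v \<bullet> w = v $ 1 * w $ 1 + v $ 2 * w $ 2 + v $ 3 * w $ 3 + v $ 4 * (w :: real^4) $ 4"
  by (simp add: inner_vec_def sum_4)

lemma bounded_linear_flip: "bounded_linear flip"
  unfolding linear_conv_bounded_linear[symmetric]
  by (rule linearI) (simp_all add: flip_def vec_eq_iff forall_4)

lemma flip_inner_commute: "flip v \<bullet> w = flip w \<bullet> v"
  by (simp add: inner_flip mult.commute)

lemma flip_inner_flip: "flip v \<bullet> flip w = v \<bullet> w"
  by (simp add: flip_def inner_vec_def sum_4)

lemma smooth_on_S3_conformal_exponent: "smooth_on_S3 conformal_exponent"
proof -
  have [intro]: "real_polynomial_function (\<lambda>q::real^4. q $ k)" for k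
    by (intro real_polynomial_function.intros(1) bounded_linear_vec_nth)
  have "conformal_exponent = (\<lambda>q. (1/8) * ((q $ 1 * q $ 1 + q $ 2 * q $ 2 + (-1) * (q $ 3 * q $ 3) + (-1) * (q $ 4 * q $ 4)) *
      (q $ 1 * q $ 1 + q $ 2 * q $ 2 + (-1) * (q $ 3 * q $ 3) + (-1) * (q $ 4 * q $ 4))))"
    by (simp add: conformal_exponent_def inner_flip fun_eq_iff power2_eq_square)
  moreover have "real_polynomial_function \<dots>"
    by (intro real_polynomial_function.intros(2-4)) auto
  ultimately have "smooth_on UNIV conformal_exponent"
    using smooth_on_polynomial by simp
  then show ?thesis unfolding smooth_on_S3_def by blast
qed

lemma has_derivative_inner_flip:
  "((\<lambda>q. flip q \<bullet> q) has_derivative (\<lambda>w. 2 * (flip q \<bullet> w))) (at q)"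
  using has_derivative_inner[OF bounded_linear.has_derivative[OF bounded_linear_flip has_derivative_ident] has_derivative_ident]
  by (rule has_derivative_eq_rhs) (simp add: fun_eq_iff inner_flip)

lemma has_derivative_conformal_exponent:
  "(conformal_exponent has_derivative (\<lambda>w. (((flip q \<bullet> q) / 2) *\<^sub>R flip q) \<bullet> w)) (at q)"
proof -
  have "((\<lambda>q. 1/8 * (flip q \<bullet> q)\<^sup>2) has_derivative
      (\<lambda>w. 1/8 * (of_nat 2 * (2 * (flip q \<bullet> w)) * (flip q \<bullet> q) ^ (2 - 1)))) (at q)"
    by (intro has_derivative_mult_right has_derivative_power has_derivative_inner_flip)
  then show ?thesis
    unfolding conformal_exponent_def[abs_def] by (simp add: field_simps)
qed

lemma has_derivative_grad_conformal_exponent: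
  "((\<lambda>q. ((flip q \<bullet> q) / 2) *\<^sub>R flip q) has_derivative
     (\<lambda>w. (flip q \<bullet> w) *\<^sub>R flip q + ((flip q \<bullet> q) / 2) *\<^sub>R flip w)) (at q)"
  using has_derivative_scaleR[OF has_derivative_mult_right[OF has_derivative_inner_flip, of "1/2"]
      bounded_linear.has_derivative[OF bounded_linear_flip has_derivative_ident]]
  by (simp add: add.commute)

text \<open>Here the gradient is (s/2) \<open>flip p\<close>, whose radial part is s^2 / 2. The
  tangential part of \<open>flip p\<close> has squared length 1 - s^2, and \<open>flip\<close> has
  trace - s on the tangent space, being traceless on R^4. So \<tau> = 2 + 2 s^2 - (1 + s^2/4)(1 -
  s^2) + s^2/2, which is the first bracket and the origin of 13/4.\<close>

lemma ricci_form_conformal_exponent: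
  fixes w :: "real^3"
  assumes p: "p \<in> sphere 0 1"
  defines "W \<equiv> (\<Sum>k\<in>UNIV. (2 * w $ k) *\<^sub>R frame p k)" and "s \<equiv> flip p \<bullet> p"
  shows "(\<Sum>j\<in>UNIV. \<Sum>k\<in>UNIV. ricci (metric_in_chart conf_metric p) j k 0 * w $ j * w $ k) =
    (W \<bullet> W) * (1 + 13/4 * s\<^sup>2 + s^4 / 4) - (flip p \<bullet> W)\<^sup>2 * (1 - s\<^sup>2 / 4) - s / 2 * (flip W \<bullet> W)"
proof -
  have pp: "p \<bullet> p = 1" using p by (simp add: norm_eq_1)
  let ?g = "\<lambda>q. ((flip q \<bullet> q) / 2) *\<^sub>R flip q"
  let ?h = "\<lambda>w. (flip p \<bullet> w) *\<^sub>R flip p + ((flip p \<bullet> p) / 2) *\<^sub>R flip w"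
  have sym: "?h v \<bullet> w = ?h w \<bullet> v" for v w
    using flip_inner_commute[of v w] by (simp add: inner_add_left)
  have s: "flip p \<bullet> p = s" "flip p \<bullet> p = s" by (simp_all add: s_def inner_commute)
  have ff: "flip p \<bullet> flip p = 1" by (simp add: flip_inner_flip pp)
  have "(\<Sum>i\<in>UNIV. (flip p \<bullet> frame p i)\<^sup>2) = 1 - s\<^sup>2"
    using sum_frame_inner[of "flip p" p "flip p"] by (simp add: power2_eq_square pp ff s)
  moreover have "(\<Sum>i\<in>UNIV. flip (frame p i) \<bullet> frame p i) = - s"
    by (simp add: s_def inner_flip sum_3 frame_def algebra_simps)
  moreover have "(\<Sum>i\<in>UNIV. ?h (frame p i) \<bullet> frame p i + (?g p \<bullet> frame p i)\<^sup>2) =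
     (1 + s\<^sup>2 / 4) * (\<Sum>i\<in>UNIV. (flip p \<bullet> frame p i)\<^sup>2) + s / 2 * (\<Sum>i\<in>UNIV. flip (frame p i) \<bullet> frame p i)"
    unfolding s by (simp add: sum_3 inner_add_left power2_eq_square algebra_simps)
  ultimately have tr: "(\<Sum>i\<in>UNIV. ?h (frame p i) \<bullet> frame p i + (?g p \<bullet> frame p i)\<^sup>2) = (1 + s\<^sup>2 / 4) * (1 - s\<^sup>2) - s / 2 * s"
    by simp
  show ?thesis
    unfolding ricci_form_conformal_round[OF p has_derivative_conformal_exponent has_derivative_grad_conformal_exponent sym]
      W_def[symmetric] tr unfolding s
    by (simp add: inner_add_left s power2_eq_square power4_eq_xxxx field_simps)
qed

text \<open>With $p = (z_1, z_2)$ and $W = (w_1, w_2)$, this is applied to $P = |z_1|^2$, $Q = |z_2|^2$, $U = |w_1|^2$,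
  $V = |w_2|^2$ and $m = \langle z_1, w_1\rangle = - \langle z_2, w_2\rangle$. The two bounds on $m^2$ are combined with
  weights $Q(1 - sP)$ and $P(1 + sQ)$, chosen so that the terms linear in $s$ cancel.\<close>
lemma ricci_polynomial_nonneg:
  fixes P Q U V m :: real
  assumes "0 \<le> P" "0 \<le> Q" "0 \<le> U" "0 \<le> V" and PQ: "P + Q = 1"
    and m: "m\<^sup>2 \<le> P * U" "m\<^sup>2 \<le> Q * V"
  defines "s \<equiv> P - Q"
  shows "0 \<le> (U + V) * (1 + 13/4 * s\<^sup>2 + s^4 / 4) - (2 * m)\<^sup>2 * (1 - s\<^sup>2 / 4) - s / 2 * (U - V)"
proof -
  have P: "P = (1 + s) / 2" and Q: "Q = (1 - s) / 2" using PQ by (simp_all add: s_def field_simps)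
  have s: "-1 \<le> s" "s \<le> 1" using assms by (simp_all add: s_def)
  have s2: "s\<^sup>2 \<le> 1" using s by (simp add: abs_square_le_1)
  have "0 \<le> Q * (1 - s * P)" "0 \<le> P * (1 + s * Q)"
  proof -
    have "s * P \<le> 1" using s mult_mono[of s 1 P 1] assms by auto
    then show "0 \<le> Q * (1 - s * P)" using \<open>0 \<le> Q\<close> by simp
    have "- s * Q \<le> 1" using s mult_mono[of "- s" 1 Q 1] assms by auto
    then have "0 \<le> 1 + s * Q" by simp
    then show "0 \<le> P * (1 + s * Q)" using \<open>0 \<le> P\<close> by (rule mult_nonneg_nonneg[rotated])
  qed
  then have "Q * (1 - s * P) * m\<^sup>2 + P * (1 + s * Q) * m\<^sup>2 \<le> Q * (1 - s * P) * (P * U) + P * (1 + s * Q) * (Q * V)"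
    using m by (intro add_mono mult_left_mono) auto
  moreover have "Q * (1 - s * P) + P * (1 + s * Q) = 1" using PQ by (simp add: algebra_simps)
  ultimately have "m\<^sup>2 \<le> Q * (1 - s * P) * (P * U) + P * (1 + s * Q) * (Q * V)"
    by (simp add: distrib_right[symmetric])
  then have "(1 - s\<^sup>2 / 4) * m\<^sup>2 \<le> (1 - s\<^sup>2 / 4) * (Q * (1 - s * P) * (P * U) + P * (1 + s * Q) * (Q * V))"
    using s2 by (intro mult_left_mono) auto
  moreover have "(U + V) * (1 + 13/4 * s\<^sup>2 + s^4 / 4) - 4 * ((1 - s\<^sup>2 / 4) * (Q * (1 - s * P) * (P * U) + P * (1 + s * Q) * (Q * V))) - s / 2 * (U - V)
    = s\<^sup>2 * ((5 - 5/8 * s - 5/8 * s\<^sup>2 + s^3/8 + s^4/8) * U + (5 + 5/8 * s - 5/8 * s\<^sup>2 - s^3/8 + s^4/8) * V)"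
    unfolding P Q power2_eq_square power3_eq_cube power4_eq_xxxx by (simp add: field_simps)
  \<comment> \<open>For |s| \<le> 1 the terms after 5 are at least - (5/8 + 5/8 + 1/8), so there is
    ample room once s^2 has been factored out.\<close>
  moreover have pos: "0 \<le> 5 - 5/8 * s - 5/8 * s\<^sup>2 + s^3/8 + s^4/8" "0 \<le> 5 + 5/8 * s - 5/8 * s\<^sup>2 - s^3/8 + s^4/8"
  proof -
    have "\<bar>s ^ 3\<bar> \<le> 1" using s by (simp add: power_abs abs_le_iff power_le_one)
    moreover have "0 \<le> s ^ 4" by simp
    ultimately show "0 \<le> 5 - 5/8 * s - 5/8 * s\<^sup>2 + s^3/8 + s^4/8" "0 \<le> 5 + 5/8 * s - 5/8 * s\<^sup>2 - s^3/8 + s^4/8"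
      using s s2 by linarith+
  qed
  moreover have "0 \<le> s\<^sup>2 * ((5 - 5/8 * s - 5/8 * s\<^sup>2 + s^3/8 + s^4/8) * U + (5 + 5/8 * s - 5/8 * s\<^sup>2 - s^3/8 + s^4/8) * V)"
    by (intro mult_nonneg_nonneg[OF zero_le_power2]
        add_nonneg_nonneg[OF mult_nonneg_nonneg mult_nonneg_nonneg] pos assms(3,4))
  moreover have "(2 * m)\<^sup>2 * (1 - s\<^sup>2 / 4) = 4 * ((1 - s\<^sup>2 / 4) * m\<^sup>2)"
    by (simp add: power_mult_distrib)
  ultimately show ?thesis by linarith
qed

text \<open>The vector \<open>W\<close> is a combination of frame vectors and hence orthogonal to
  \<open>p\<close>. This orthogonality gives the opposite signs of the inner products in the two
  complex factors, and Cauchy-Schwarz in each factor gives the two bounds on m^2.\<close>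

lemma nonneg_Ricci_conformal_exponent: "nonneg_Ricci conf_metric"
  unfolding nonneg_Ricci_def Ric_def
proof (intro ballI allI impI)
  fix p v :: "real^4" assume p: "p \<in> sphere 0 1"
  define w where "w = components p v"
  define W where "W = (\<Sum>k\<in>UNIV. (2 * w $ k) *\<^sub>R frame p k)"
  have "p \<bullet> p = 1" using p by (simp add: norm_eq_1)
  moreover have "W \<bullet> p = 0" by (simp add: W_def inner_sum_left frame_orthogonal)
  ultimately have "0 \<le> (W \<bullet> W) * (1 + 13/4 * (flip p \<bullet> p)\<^sup>2 + (flip p \<bullet> p)^4 / 4)
     - (flip p \<bullet> W)\<^sup>2 * (1 - (flip p \<bullet> p)\<^sup>2 / 4) - (flip p \<bullet> p) / 2 * (flip W \<bullet> W)"
  proof -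
    define m where "m = p $ 1 * W $ 1 + p $ 2 * W $ 2"
    define P where "P = (p $ 1)\<^sup>2 + (p $ 2)\<^sup>2"
    define Q where "Q = (p $ 3)\<^sup>2 + (p $ 4)\<^sup>2"
    define U where "U = (W $ 1)\<^sup>2 + (W $ 2)\<^sup>2"
    define V where "V = (W $ 3)\<^sup>2 + (W $ 4)\<^sup>2"
    assume *: "p \<bullet> p = 1" "W \<bullet> p = 0"
    have m': "p $ 3 * W $ 3 + p $ 4 * W $ 4 = - m" using *(2) by (simp add: inner_4 m_def mult.commute)
    have cs: "(a * c + b * d)\<^sup>2 \<le> (a\<^sup>2 + b\<^sup>2) * (c\<^sup>2 + d\<^sup>2)" for a b c d :: real
    proof -
      have "(a\<^sup>2 + b\<^sup>2) * (c\<^sup>2 + d\<^sup>2) - (a * c + b * d)\<^sup>2 = (a * d - b * c)\<^sup>2"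
        by (simp add: power2_eq_square algebra_simps)
      then show ?thesis using zero_le_power2[of "a * d - b * c"] by linarith
    qed
    have "m\<^sup>2 \<le> P * U"
      using cs[of "p $ 1" "W $ 1" "p $ 2" "W $ 2"] by (simp add: m_def P_def U_def)
    moreover have "m\<^sup>2 \<le> Q * V"
      using cs[of "p $ 3" "W $ 3" "p $ 4" "W $ 4"] unfolding m' by (simp add: Q_def V_def)
    moreover have "P + Q = 1" using *(1) by (simp add: inner_4 P_def Q_def power2_eq_square)
    moreover have "0 \<le> P" "0 \<le> Q" "0 \<le> U" "0 \<le> V" by (simp_all add: P_def Q_def U_def V_def)
    ultimately have "0 \<le> (U + V) * (1 + 13/4 * (P - Q)\<^sup>2 + (P - Q)^4 / 4) - (2 * m)\<^sup>2 * (1 - (P - Q)\<^sup>2 / 4) - (P - Q) / 2 * (U - V)"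
      using ricci_polynomial_nonneg by blast
    moreover have "flip p \<bullet> p = P - Q" "flip W \<bullet> W = U - V"
      by (simp_all add: inner_flip P_def Q_def U_def V_def power2_eq_square)
    moreover have "W \<bullet> W = U + V"
      by (simp add: inner_4 U_def V_def power2_eq_square)
    moreover have "flip p \<bullet> W = 2 * m"
      using m' by (simp add: inner_flip m_def mult.commute)
    ultimately show ?thesis by simp
  qed
  then show "0 \<le> (\<Sum>j\<in>UNIV. \<Sum>k\<in>UNIV. ricci (metric_in_chart conf_metric p) j k 0 * components p v $ j * components p v $ k)"
    unfolding w_def[symmetric] ricci_form_conformal_exponent[OF p] W_def[symmetric] .
qed

section \<open>The second fundamental form\<close>

lemma has_derivative_stereo:
  assumes "1 + q \<bullet> p \<noteq> 0"
  shows "(stereo p has_derivative (\<lambda>v. (1 / (1 + q \<bullet> p)) *\<^sub>R (\<chi> k. v \<bullet> frame p k)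
     - ((v \<bullet> p) / (1 + q \<bullet> p)\<^sup>2) *\<^sub>R (\<chi> k. q \<bullet> frame p k))) (at q)"
proof -
  have "((\<lambda>q. q \<bullet> frame p k / (1 + q \<bullet> p)) has_derivative
     (\<lambda>v. v \<bullet> frame p k / (1 + q \<bullet> p) - (v \<bullet> p) / (1 + q \<bullet> p)\<^sup>2 * (q \<bullet> frame p k))) (at q)" for k
    by (rule derivative_eq_intros assms refl)+
      (use assms in \<open>simp add: fun_eq_iff divide_simps power2_eq_square algebra_simps\<close>)
  then show ?thesis
    unfolding stereo_def[abs_def]
    by (subst has_derivative_componentwise_within) (auto simp: Basis_vec_def inner_axis)
qed

text \<open>The differential of the chart at its centre has the factor 1 / (1 +
  \<open>p \<bullet> p\<close>) = 1/2, inverse to the factor 2 of the coordinate vectors.\<close>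

lemma components_tangent:
  assumes "p \<in> sphere 0 1" "v \<bullet> p = 0"
  shows "components p v $ k = (v \<bullet> frame p k) / 2"
proof -
  have pp: "p \<bullet> p = 1" using assms by (simp add: norm_eq_1)
  then have "1 + p \<bullet> p \<noteq> 0" by simp
  from has_derivative_stereo[OF this]
  show ?thesis
    unfolding components_def by (simp add: frechet_derivative_at[symmetric] assms(2) pp)
qed

text \<open>At the centre the terms of the quotient rule vanish: \<open>F x\<close> is orthogonal to
  its frame, and \<open>F \<bullet> F x\<close> has derivative 0 at \<open>x\<close> by tangency.
  Only the Euclidean second derivative, halved by the chart, survives.\<close>

lemma partial_partial_stereo:
  fixes F :: "real^2 \<Rightarrow> real^4"
  assumes sphere: "F x \<in> sphere 0 1"
    and F: "\<And>y. (F has_derivative F' y) (at y)"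
    and F'': "((\<lambda>y. F' y (axis j 1)) has_derivative D) (at x)"
    and tangent: "\<And>v. F' x v \<bullet> F x = 0"
  shows "partial i (partial j (\<lambda>y. stereo (F x) (F y))) x = (\<chi> k. (D (axis i 1) \<bullet> frame (F x) k) / 2)"
proof -
  let ?p = "F x"
  have pp: "?p \<bullet> ?p = 1" using sphere by (simp add: norm_eq_1)
  \<comment> \<open>The chart is singular at the antipode of \<open>?p\<close>, so the formula for
    the first derivative holds only on this open set; a neighbourhood of \<open>x\<close> suffices
    for the second derivative.\<close>
  define S where "S = {y. 1 + F y \<bullet> ?p \<noteq> 0}"
  have cF: "continuous_on UNIV F"
    using F by (auto intro!: continuous_at_imp_continuous_on has_derivative_continuous)
  have "open S"
  proof -
    have "S = (\<lambda>y. 1 + F y \<bullet> ?p) -` (- {0})" by (auto simp: S_def)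
    then show ?thesis by (auto intro!: open_vimage continuous_intros cF)
  qed
  moreover have "x \<in> S" by (simp add: S_def pp)
  moreover define f where "f y = (1 / (1 + F y \<bullet> ?p)) *\<^sub>R (\<chi> k. F' y (axis j 1) \<bullet> frame ?p k)
     - ((F' y (axis j 1) \<bullet> ?p) / (1 + F y \<bullet> ?p)\<^sup>2) *\<^sub>R (\<chi> k. F y \<bullet> frame ?p k)" for y
  have "f y = partial j (\<lambda>y. stereo ?p (F y)) y" if "y \<in> S" for y
    unfolding f_def
    by (rule partial_eqI[OF has_derivative_compose[OF F has_derivative_stereo], symmetric])
      (use that in \<open>simp add: S_def\<close>)
  moreover have "(f has_derivative (\<lambda>v. \<chi> k. (D v \<bullet> frame ?p k) / 2)) (at x)"
  proof -
    have "((\<lambda>y. (1 / (1 + F y \<bullet> ?p)) * (F' y (axis j 1) \<bullet> frame ?p k)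
       - ((F' y (axis j 1) \<bullet> ?p) / (1 + F y \<bullet> ?p)\<^sup>2) * (F y \<bullet> frame ?p k)) has_derivative
       (\<lambda>v. (D v \<bullet> frame ?p k) / 2)) (at x)" for k
      by (rule derivative_eq_intros F F'' refl | simp add: pp)+
        (simp add: fun_eq_iff tangent pp inner_commute[of ?p] frame_orthogonal)
    then show ?thesis
      unfolding f_def[abs_def]
      by (subst has_derivative_componentwise_within) (auto simp: Basis_vec_def inner_axis)
  qed
  ultimately have "(partial j (\<lambda>y. stereo ?p (F y)) has_derivative (\<lambda>v. \<chi> k. (D v \<bullet> frame ?p k) / 2)) (at x)"
    by (metis (no_types, lifting) has_derivative_transform_within_open)
  from partial_eqI[OF this] show ?thesis .
qed

text \<open>Where \<phi> and its gradient vanish, the Christoffel symbols at the chart centre are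
  zero, as for the round metric, and the second fundamental form is the Euclidean second derivative
  against \<open>N\<close>. The factors are 4 from the metric and 1/2 twice from the chart
  components; Parseval then removes the frame, as \<open>N\<close> is orthogonal to the
  position.\<close>

lemma second_fundamental_conformal_round:
  fixes F :: "real^2 \<Rightarrow> real^4"
  assumes sphere: "F x \<in> sphere 0 1"
    and F: "\<And>y. (F has_derivative F' y) (at y)"
    and F'': "((\<lambda>y. F' y (axis j 1)) has_derivative D) (at x)"
    and tangent: "\<And>v. F' x v \<bullet> F x = 0"
    and N: "N x \<bullet> F x = 0"
    and g: "\<And>q. (\<phi> has_derivative (\<lambda>w. g q \<bullet> w)) (at q)"
    and h: "(g has_derivative h) (at (F x))"
    and crit: "\<phi> (F x) = 0" "g (F x) = 0"
  shows "second_fundamental (conformal \<phi> round_metric) F N i j x = D (axis i 1) \<bullet> N x"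
proof -
  let ?p = "F x"
  have pp: "?p \<bullet> ?p = 1" using sphere by (simp add: norm_eq_1)
  note c = chart_conformal_factor[OF sphere g h]
  have "christoffel (metric_in_chart (conformal \<phi> round_metric) ?p) k a b 0 = 0" for k a b
    unfolding christoffel_conformally_flat[OF metric_in_chart_conformal_round[OF sphere, of \<phi>] c(1)] c(3)
    by (simp add: crit)
  then have cov: "covariant_second (conformal \<phi> round_metric) F i j x $ k = (D (axis i 1) \<bullet> frame ?p k) / 2" for k
    unfolding covariant_second_def Let_def
    by (simp add: partial_partial_stereo[OF sphere F F'' tangent])
  have m: "metric_in_chart (conformal \<phi> round_metric) ?p 0 $ a $ b = (if a = b then 4 else 0)" for a b
    unfolding metric_in_chart_conformal_round[OF sphere] by (simp add: mat_def stereo_inv_0 crit exp_double)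
  have "second_fundamental (conformal \<phi> round_metric) F N i j x =
    (\<Sum>k\<in>UNIV. (D (axis i 1) \<bullet> frame ?p k) * (N x \<bullet> frame ?p k))"
    unfolding second_fundamental_def m cov components_tangent[OF sphere N] by (simp add: sum_3)
  then show ?thesis by (simp add: sum_frame_inner pp N)
qed

section \<open>Geometry of the Clifford torus in the conformal metric\<close>

lemma clifford_sphere: "clifford x \<in> sphere 0 1"
proof -
  have "range clifford \<subseteq> sphere 0 1" using torus_embedding_clifford by (simp add: torus_embedding_def)
  then show ?thesis by blast
qed

lemma sin_cos_mult: "sin t * sin t + cos t * cos t = (1::real)"
  by (metis add.commute sin_cos_squared_add3)

lemma inner_trig_map:
  "trig_map (axis 1 a) (axis 2 b) (axis 3 c) (axis 4 d) x \<bullet> trig_map (axis 1 a') (axis 2 b') (axis 3 c') (axis (4::4) d') x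
    = a * a' * (cos (2 * pi * x $ 1))\<^sup>2 + b * b' * (sin (2 * pi * x $ 1))\<^sup>2
    + c * c' * (cos (2 * pi * x $ 2))\<^sup>2 + d * d' * (sin (2 * pi * x $ 2))\<^sup>2"
  by (simp add: inner_4 trig_map_axis_nth power2_eq_square)

lemma flip_clifford: "flip (clifford x) = clifford_normal x"
  by (simp add: vec_eq_iff forall_4 flip_def clifford_nth)

lemma inner_flip_clifford: "flip (clifford x) \<bullet> clifford x = 0"
proof -
  have half: "a * a / 2 + b * b / 2 - c * c / 2 - d * d / 2 = 0"
    if "a * a + b * b = 1" "c * c + d * d = 1" for a b c d :: real
    using that by (simp add: field_simps)
  then show ?thesis by (simp add: inner_flip clifford_nth half del: right_minus_eq)
qed

lemma inner_clifford_normal: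
  "clifford_normal x \<bullet> clifford x = 0" "clifford_normal x \<bullet> clifford_normal x = 1"
proof -
  show "clifford_normal x \<bullet> clifford x = 0" using inner_flip_clifford[of x] by (simp add: flip_clifford)
  have "clifford_normal x \<bullet> clifford_normal x = clifford x \<bullet> clifford x"
    unfolding flip_clifford[symmetric] by (rule flip_inner_flip)
  then show "clifford_normal x \<bullet> clifford_normal x = 1" using clifford_sphere[of x] by (simp add: norm_eq_1)
qed

lemma metric_on_clifford: "conf_metric (clifford x) v w = v \<bullet> w"
  by (simp add: conformal_def round_metric_def conformal_exponent_def inner_flip_clifford)

lemma partial_clifford_nth:
  "partial i clifford x $ k =
    (if i = 1 then (if k = 1 then - (2 * pi / sqrt 2) * sin (2 * pi * x $ 1)
                    else if k = 2 then 2 * pi / sqrt 2 * cos (2 * pi * x $ 1) else 0)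
     else (if k = 3 then - (2 * pi / sqrt 2) * sin (2 * pi * x $ 2)
           else if k = 4 then 2 * pi / sqrt 2 * cos (2 * pi * x $ 2) else 0))"
  using exhaust_4[of k] by (auto simp: partial_clifford trig_map_def axis_def)

lemma inner_partial_clifford:
  "partial i clifford x \<bullet> partial j clifford x = (if i = j then 2 * pi\<^sup>2 else 0)"
proof -
  define r where "r = 2 * pi / sqrt 2"
  have "r * r = 2 * pi\<^sup>2" by (simp add: r_def power2_eq_square)
  moreover have "(r * a) * (r * a) + (r * b) * (r * b) = r * r * (a * a + b * b)" for a b
    by (simp add: algebra_simps)
  ultimately have "(r * sin t) * (r * sin t) + (r * cos t) * (r * cos t) = 2 * pi\<^sup>2" for t
    by (simp add: sin_cos_mult)
  then show ?thesis
    using exhaust_2[of i] exhaust_2[of j] unfolding inner_4 partial_clifford_nth[folded r_def] by auto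
qed

text \<open>Each circle has radius 1 / sqrt 2 and is traversed with speed 2 pi / sqrt 2, and the two
  circles lie in orthogonal planes.\<close>

lemma first_fundamental_clifford:
  "first_fundamental conf_metric clifford x = mat (2 * pi\<^sup>2)"
  by (simp add: first_fundamental_def metric_on_clifford inner_partial_clifford mat_def vec_eq_iff)

lemma unit_normal_clifford: "unit_normal conf_metric clifford clifford_normal"
  unfolding unit_normal_def metric_on_clifford
proof (intro conjI allI)
  show "clifford_normal x \<bullet> partial i clifford x = 0" for x i
    using exhaust_2[of i] by (auto simp: inner_4 partial_clifford_nth clifford_nth)
qed (simp_all add: clifford_normal_def smooth_on_trig_map doubly_periodic_trig_map inner_clifford_normal[unfolded clifford_normal_def])

text \<open>Differentiating twice in one variable multiplies the corresponding circle by - 4 pi^2.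
  The normal is that circle up to the sign + or -, with squared length 1/2 in its plane. Mixed
  derivatives vanish because each coordinate depends on one variable. So the principal curvatures
  are -1 and 1.\<close>

lemma second_fundamental_clifford:
  "second_fundamental conf_metric clifford clifford_normal i j x =
    (if i = j then if i = 1 then - (2 * pi\<^sup>2) else 2 * pi\<^sup>2 else 0)"
proof -
  let ?a = "\<lambda>k. axis k (1 / sqrt 2) :: real^4"
  let ?F' = "\<lambda>y v. trig_map ((2 * pi * v $ 1) *\<^sub>R ?a 2) (- (2 * pi * v $ 1) *\<^sub>R ?a 1)
                           ((2 * pi * v $ 2) *\<^sub>R ?a 4) (- (2 * pi * v $ 2) *\<^sub>R ?a 3) y"
  have F: "(clifford has_derivative ?F' y) (at y)" for y
    unfolding clifford_def by (rule has_derivative_trig_map)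
  have tangent: "?F' x v \<bullet> clifford x = 0" for v :: "real^2"
    by (simp add: inner_4 clifford_nth) (simp add: trig_map_def axis_def)
  have crit: "conformal_exponent (clifford x) = 0" "((flip (clifford x) \<bullet> clifford x) / 2) *\<^sub>R flip (clifford x) = 0"
    by (simp_all add: conformal_exponent_def inner_flip_clifford)
  define a where "a = - (4 * pi\<^sup>2) / sqrt 2"
  have a: "a * (1 / sqrt 2) = - (2 * pi\<^sup>2)" "a * (- 1 / sqrt 2) = 2 * pi\<^sup>2"
    by (simp_all add: a_def)
  have second: "trig_map ((2 * pi * axis i 1 $ 1) *\<^sub>R - (2 * pi * axis j 1 $ 1) *\<^sub>R ?a 1)
     (- (2 * pi * axis i 1 $ 1) *\<^sub>R (2 * pi * axis j 1 $ 1) *\<^sub>R ?a 2)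
     ((2 * pi * axis i 1 $ 2) *\<^sub>R - (2 * pi * axis j 1 $ 2) *\<^sub>R ?a 3)
     (- (2 * pi * axis i 1 $ 2) *\<^sub>R (2 * pi * axis j 1 $ 2) *\<^sub>R ?a 4) x =
     trig_map (axis 1 (if i = 1 \<and> j = 1 then a else 0)) (axis 2 (if i = 1 \<and> j = 1 then a else 0))
       (axis 3 (if i = 2 \<and> j = 2 then a else 0)) (axis 4 (if i = 2 \<and> j = 2 then a else 0)) x"
    using exhaust_2[of i] exhaust_2[of j]
    by (auto simp: vec_eq_iff forall_4 trig_map_def axis_def a_def power2_eq_square)
  have dist: "c * (cos t)\<^sup>2 + c * (sin t)\<^sup>2 = c" for c t :: real
    by (simp flip: distrib_left)
  have "a * (cos t)\<^sup>2 / sqrt 2 + a * (sin t)\<^sup>2 / sqrt 2 = - (2 * pi\<^sup>2)" for t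
    using dist[of "a / sqrt 2" t] a(1) by simp
  moreover from this have "- (a * (cos t)\<^sup>2 / sqrt 2) - a * (sin t)\<^sup>2 / sqrt 2 = 2 * pi\<^sup>2" for t
    by (smt (verit))
  moreover have F'': "((\<lambda>y. ?F' y (axis j 1)) has_derivative (\<lambda>v.
     trig_map ((2 * pi * v $ 1) *\<^sub>R - (2 * pi * axis j 1 $ 1) *\<^sub>R ?a 1)
     (- (2 * pi * v $ 1) *\<^sub>R (2 * pi * axis j 1 $ 1) *\<^sub>R ?a 2)
     ((2 * pi * v $ 2) *\<^sub>R - (2 * pi * axis j 1 $ 2) *\<^sub>R ?a 3)
     (- (2 * pi * v $ 2) *\<^sub>R (2 * pi * axis j 1 $ 2) *\<^sub>R ?a 4) x)) (at x)"
    by (rule has_derivative_trig_map)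
  ultimately show ?thesis
    unfolding second_fundamental_conformal_round[where F = clifford and F' = ?F' and N = clifford_normal and x = x
      and \<phi> = conformal_exponent and g = "\<lambda>q. ((flip q \<bullet> q) / 2) *\<^sub>R flip q", OF clifford_sphere F F'' tangent
      inner_clifford_normal(1) has_derivative_conformal_exponent has_derivative_grad_conformal_exponent crit]
      second
    unfolding clifford_normal_def minus_axis inner_trig_map
    using exhaust_2[of i] exhaust_2[of j] by auto
qed

lemma jacobi_potential_clifford:
  "jacobi_potential conf_metric clifford clifford_normal x = 2"
proof -
  let ?w = "components (clifford x) (clifford_normal x)"
  define W where "W = (\<Sum>k\<in>UNIV. (2 * ?w $ k) *\<^sub>R frame (clifford x) k)"
  have w: "?w $ k = (clifford_normal x \<bullet> frame (clifford x) k) / 2" for k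
    by (rule components_tangent[OF clifford_sphere inner_clifford_normal(1)])
  have cc: "clifford x \<bullet> clifford x = 1" using clifford_sphere[of x] by (simp add: norm_eq_1)
  have WN: "W \<bullet> clifford_normal x = 1"
  proof -
    have "W \<bullet> clifford_normal x = (\<Sum>k\<in>UNIV. (clifford_normal x \<bullet> frame (clifford x) k) * (clifford_normal x \<bullet> frame (clifford x) k))"
      by (simp add: W_def w sum_3 inner_add_left inner_commute[of "frame (clifford x) _"])
    then show ?thesis by (simp add: sum_frame_inner inner_clifford_normal cc)
  qed
  have WW: "W \<bullet> W = 1"
  proof -
    have "W \<bullet> W = (\<Sum>k\<in>UNIV. (clifford_normal x \<bullet> frame (clifford x) k) * (clifford_normal x \<bullet> frame (clifford x) k))"
      by (simp add: W_def w sum_3 inner_add_left inner_add_right frame_orthonormal[OF clifford_sphere])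
    then show ?thesis by (simp add: sum_frame_inner inner_clifford_normal cc)
  qed
  \<comment> \<open>At s = 0 the Ricci form is |W|^2 - (\<open>flip p \<bullet> W\<close>)^2, and
    \<open>flip p\<close> is the normal, so the value is 1 - 1.\<close>
  have "Ric conf_metric (clifford x) (clifford_normal x) (clifford_normal x) = 0"
    unfolding Ric_def ricci_form_conformal_exponent[OF clifford_sphere] W_def[symmetric] WW
    using WN by (simp add: inner_flip_clifford) (simp add: flip_clifford inner_commute)
  moreover have "sigma_norm_sq conf_metric clifford clifford_normal x = 2"
  proof -
    define c where "c = 2 * pi\<^sup>2"
    have "c \<noteq> 0" by (simp add: c_def)
    then show ?thesis
      unfolding sigma_norm_sq_def first_fundamental_clifford Let_def second_fundamental_clifford c_def[symmetric]
      by (simp add: matrix_inv_mat_nth sum_2 field_simps)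
  qed
  ultimately show ?thesis by (simp add: jacobi_potential_def)
qed

lemma minimal_clifford: "minimal conf_metric clifford clifford_normal"
  unfolding minimal_def mean_curvature_def first_fundamental_clifford second_fundamental_clifford
  by (simp add: matrix_inv_mat_nth sum_2)

section \<open>Wirtinger's inequality\<close>

text \<open>Completing the square: with t the tangent centred at the midpoint, t' = c (1 + t^2)
  gives h'^2 - c^2 h^2 + (c t h^2)' = (h' + c t h)^2. The boundary terms vanish with
  \<open>h\<close>, and \<open>c * (b - a) < pi\<close> keeps the poles of the tangent outside the
  closed interval.\<close>

lemma wirtinger_dirichlet_strict:
  fixes h h' :: "real \<Rightarrow> real"
  assumes "a \<le> b" "h a = 0" "h b = 0" "0 < c" "c * (b - a) < pi"
    and der: "\<And>x. (h has_real_derivative h' x) (at x)"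
    and cont: "continuous_on UNIV h'"
  shows "c\<^sup>2 * integral {a..b} (\<lambda>x. (h x)\<^sup>2) \<le> integral {a..b} (\<lambda>x. (h' x)\<^sup>2)"
proof -
  define t where "t x = tan (c * (x - (a + b) / 2))" for x
  define G where "G x = c * t x * (h x)\<^sup>2" for x
  define G' where "G' x = c\<^sup>2 * (1 + (t x)\<^sup>2) * (h x)\<^sup>2 + 2 * c * t x * h x * h' x" for x
  have cos: "cos (c * (x - (a + b) / 2)) > 0" if "x \<in> {a..b}" for x
  proof (rule cos_gt_zero_pi)
    have "\<bar>x - (a + b) / 2\<bar> \<le> (b - a) / 2" using that by (auto simp: abs_if field_simps)
    then have "c * \<bar>x - (a + b) / 2\<bar> \<le> c * ((b - a) / 2)" using \<open>0 < c\<close> by simp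
    also have "\<dots> < pi / 2" using assms(5) by simp
    finally have "\<bar>c * (x - (a + b) / 2)\<bar> < pi / 2" using \<open>0 < c\<close> by (simp add: abs_mult)
    then show "- (pi / 2) < c * (x - (a + b) / 2)" "c * (x - (a + b) / 2) < pi / 2" by linarith+
  qed
  have G: "(G has_real_derivative G' x) (at x)" if "x \<in> {a..b}" for x
  proof -
    have "inverse ((cos (c * (x - (a + b) / 2)))\<^sup>2) = 1 + (t x)\<^sup>2"
      unfolding t_def using tan_sec[OF less_imp_neq[OF cos[OF that], symmetric]] by (simp only: power_inverse)
    moreover have "((\<lambda>x. c * (x - (a + b) / 2)) has_real_derivative c) (at x)"
      by (auto intro!: derivative_eq_intros)
    from DERIV_chain2[OF DERIV_tan[OF less_imp_neq[OF cos[OF that], symmetric]] this]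
    have "(t has_real_derivative inverse ((cos (c * (x - (a + b) / 2)))\<^sup>2) * c) (at x)"
      unfolding t_def .
    ultimately have dt: "(t has_real_derivative c * (1 + (t x)\<^sup>2)) (at x)"
      by (simp only: mult.commute)
    have "((\<lambda>x. (c * t x) * (h x * h x)) has_real_derivative
        (c * (c * (1 + (t x)\<^sup>2))) * (h x * h x) + (h' x * h x + h' x * h x) * (c * t x)) (at x)"
      by (intro DERIV_mult DERIV_cmult dt der)
    then show ?thesis
      unfolding G_def G'_def by (simp only: power2_eq_square) (simp add: mult_ac distrib_left)
  qed
  have "(G' has_integral G b - G a) {a..b}"
    by (rule fundamental_theorem_of_calculus[OF \<open>a \<le> b\<close>])
      (use G in \<open>auto simp: has_real_derivative_iff_has_vector_derivative intro: has_vector_derivative_at_within\<close>)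
  then have 0: "(G' has_integral 0) {a..b}" by (simp add: G_def assms)
  have ch: "continuous_on A h" for A
    using der by (intro DERIV_continuous_on) (auto intro: has_field_derivative_at_within)
  have int: "(\<lambda>x. (h x)\<^sup>2) integrable_on {a..b}" "(\<lambda>x. (h' x)\<^sup>2) integrable_on {a..b}"
    by (intro integrable_continuous_real continuous_intros ch continuous_on_subset[OF cont] subset_UNIV)+
  have "((\<lambda>x. (h' x)\<^sup>2 - c\<^sup>2 * (h x)\<^sup>2) has_integral
     integral {a..b} (\<lambda>x. (h' x)\<^sup>2) - c\<^sup>2 * integral {a..b} (\<lambda>x. (h x)\<^sup>2)) {a..b}"
    by (intro has_integral_diff has_integral_mult_right integrable_integral int)
  moreover have "0 \<le> (h' x)\<^sup>2 - c\<^sup>2 * (h x)\<^sup>2 + G' x" for x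
  proof -
    have "(h' x)\<^sup>2 - c\<^sup>2 * (h x)\<^sup>2 + G' x = (h' x + c * t x * h x)\<^sup>2"
      by (simp add: G'_def power2_eq_square algebra_simps)
    then show ?thesis by simp
  qed
  ultimately have "0 \<le> integral {a..b} (\<lambda>x. (h' x)\<^sup>2) - c\<^sup>2 * integral {a..b} (\<lambda>x. (h x)\<^sup>2) + 0"
    using 0 by (blast intro: has_integral_nonneg[OF has_integral_add])
  then show ?thesis by simp
qed

text \<open>At the sharp constant the tangent has poles at both ends, so that constant is reached as
  a limit from below.\<close>

lemma wirtinger_dirichlet:
  fixes h h' :: "real \<Rightarrow> real"
  assumes "a < b" "h a = 0" "h b = 0"
    and der: "\<And>x. (h has_real_derivative h' x) (at x)"
    and cont: "continuous_on UNIV h'"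
  shows "(pi / (b - a))\<^sup>2 * integral {a..b} (\<lambda>x. (h x)\<^sup>2) \<le> integral {a..b} (\<lambda>x. (h' x)\<^sup>2)"
proof (rule tendsto_upperbound)
  let ?c = "pi / (b - a)"
  have c: "?c > 0" using assms by simp
  show "((\<lambda>c. c\<^sup>2 * integral {a..b} (\<lambda>x. (h x)\<^sup>2)) \<longlongrightarrow> ?c\<^sup>2 * integral {a..b} (\<lambda>x. (h x)\<^sup>2)) (at_left ?c)"
    by (intro tendsto_intros)
  show "\<forall>\<^sub>F c in at_left ?c. c\<^sup>2 * integral {a..b} (\<lambda>x. (h x)\<^sup>2) \<le> integral {a..b} (\<lambda>x. (h' x)\<^sup>2)"
    using eventually_at_left_real[OF c]
  proof eventually_elim
    case (elim c)
    then show ?case using assms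
      by (intro wirtinger_dirichlet_strict) (auto simp: field_simps)
  qed
qed simp

section \<open>Periodic functions of one and two real variables\<close>

lemma has_integral_periodic_derivative:
  fixes f f' :: "real \<Rightarrow> real"
  assumes "\<And>x. (f has_real_derivative f' x) (at x)" "f 1 = f 0"
  shows "(f' has_integral 0) {0..1}"
proof -
  have "(f' has_integral f 1 - f 0) {0..1}"
    using assms(1) by (intro fundamental_theorem_of_calculus)
      (auto simp: has_real_derivative_iff_has_vector_derivative intro: has_vector_derivative_at_within)
  then show ?thesis by (simp add: assms(2))
qed

lemma integral_periodic_shift:
  fixes f :: "real \<Rightarrow> real"
  assumes cont: "continuous_on UNIV f" and per: "\<And>x. f (x + 1) = f x" and a: "0 \<le> a" "a \<le> 1"
  shows "integral {a..a + 1} f = integral {0..1} f"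
proof -
  have int: "f integrable_on {u..v}" for u v
    by (intro integrable_continuous_real continuous_on_subset[OF cont] subset_UNIV)
  have "integral {1..a + 1} f = integral {0..a} f"
  proof -
    have "((\<lambda>x. f (x + 1)) has_integral integral {1..a + 1} f) {0..a}"
      using has_integral_affinity[of f "integral {1..a+1} f" 1 "a+1" 1 1] integrable_integral[OF int, of 1 "a+1"]
      using image_affinity_atLeastAtMost_diff[of 1 1 1 "a+1"] a by simp
    then have "(f has_integral integral {1..a + 1} f) {0..a}" by (simp add: per)
    then show ?thesis by (rule integral_unique[symmetric])
  qed
  moreover have "integral {a..1} f + integral {1..a + 1} f = integral {a..a + 1} f"
    using a by (intro Henstock_Kurzweil_Integration.integral_combine int) auto
  moreover have "integral {0..a} f + integral {a..1} f = integral {0..1} f"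
    using a by (intro Henstock_Kurzweil_Integration.integral_combine int) auto
  ultimately show ?thesis by linarith
qed

text \<open>Subtracting the common value of \<^term>\<open>f\<close> at two points half a period apart reduces the
  inequality to the Dirichlet case on two half periods.\<close>
lemma wirtinger_periodic:
  fixes f f' :: "real \<Rightarrow> real"
  assumes der: "\<And>x. (f has_real_derivative f' x) (at x)"
    and cont: "continuous_on UNIV f'" and per: "\<And>x. f (x + 1) = f x"
    and mean: "integral {0..1} f = 0"
  shows "4 * pi\<^sup>2 * integral {0..1} (\<lambda>x. (f x)\<^sup>2) \<le> integral {0..1} (\<lambda>x. (f' x)\<^sup>2)"
proof -
  have cf: "continuous_on A f" for A
    using der by (intro DERIV_continuous_on) (auto intro: has_field_derivative_at_within)
  have cf': "continuous_on A f'" for A using cont continuous_on_subset by blast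
  have per': "f' (x + 1) = f' x" for x
  proof (rule DERIV_unique[OF _ der])
    show "(f has_real_derivative f' (x + 1)) (at x)"
      using DERIV_shift[of f "f' (x+1)" x 1] der[of "x+1"] by (simp add: per)
  qed
  obtain a where a: "0 \<le> a" "a \<le> 1/2" "f (a + 1/2) = f a"
  proof -
    define g where "g x = f (x + 1/2) - f x" for x
    have cg: "continuous_on {0..1/2} g"
      unfolding g_def
      by (intro continuous_intros cf continuous_on_compose2[of UNIV f]) auto
    \<comment> \<open>The change of sign over half a period makes the intermediate value theorem
      produce \<open>a\<close>.\<close>
    have 1: "g (1/2) = - g 0" using per[of 0] by (simp add: g_def)
    have "\<exists>x\<ge>0. x \<le> 1/2 \<and> g x = 0"
    proof (cases "g 0 \<le> 0")
      case True
      then show ?thesis using 1 by (intro IVT' cg) auto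
    next
      case False
      then show ?thesis using 1 by (intro IVT2' cg) auto
    qed
    then show ?thesis using that by (auto simp: g_def)
  qed
  define h where "h x = f x - f a" for x
  have dh: "(h has_real_derivative f' x) (at x)" for x
    unfolding h_def by (auto intro!: derivative_eq_intros der)
  have h0: "h a = 0" "h (a + 1/2) = 0" "h (a + 1) = 0" using a per[of a] by (auto simp: h_def)
  have perh: "h (x + 1) = h x" for x by (simp add: h_def per)
  have ch: "continuous_on A h" for A unfolding h_def by (intro continuous_intros cf)
  have inth: "(\<lambda>x. (h x)\<^sup>2) integrable_on {u..v}" "(\<lambda>x. (f' x)\<^sup>2) integrable_on {u..v}" for u v
    by (intro integrable_continuous_real continuous_intros ch cf')+
  \<comment> \<open>On an interval of length 1/2 the Dirichlet constant (pi / (1/2))^2 is already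
    the sharp periodic one.\<close>
  have "4 * pi\<^sup>2 * integral {u..u + 1/2} (\<lambda>x. (h x)\<^sup>2) \<le> integral {u..u + 1/2} (\<lambda>x. (f' x)\<^sup>2)"
    if "h u = 0" "h (u + 1/2) = 0" for u
    using wirtinger_dirichlet[of u "u + 1/2" h f'] that dh cont by (simp add: power_mult_distrib)
  from this[of a] this[of "a + 1/2"] h0
  have "4 * pi\<^sup>2 * (integral {a..a + 1/2} (\<lambda>x. (h x)\<^sup>2) + integral {a + 1/2..a + 1} (\<lambda>x. (h x)\<^sup>2))
     \<le> integral {a..a + 1/2} (\<lambda>x. (f' x)\<^sup>2) + integral {a + 1/2..a + 1} (\<lambda>x. (f' x)\<^sup>2)"
    by (simp add: distrib_left add.assoc)
  also have "integral {a..a + 1/2} (\<lambda>x. (f' x)\<^sup>2) + integral {a + 1/2..a + 1} (\<lambda>x. (f' x)\<^sup>2)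
      = integral {a..a + 1} (\<lambda>x. (f' x)\<^sup>2)"
    by (intro Henstock_Kurzweil_Integration.integral_combine inth) auto
  also have "integral {a..a + 1/2} (\<lambda>x. (h x)\<^sup>2) + integral {a + 1/2..a + 1} (\<lambda>x. (h x)\<^sup>2)
      = integral {a..a + 1} (\<lambda>x. (h x)\<^sup>2)"
    by (intro Henstock_Kurzweil_Integration.integral_combine inth) auto
  also have "integral {a..a + 1} (\<lambda>x. (h x)\<^sup>2) = integral {0..1} (\<lambda>x. (h x)\<^sup>2)"
    using a by (intro integral_periodic_shift) (auto simp: perh intro!: continuous_intros ch)
  also have "integral {a..a + 1} (\<lambda>x. (f' x)\<^sup>2) = integral {0..1} (\<lambda>x. (f' x)\<^sup>2)"
    using a by (intro integral_periodic_shift) (auto simp: per' intro!: continuous_intros cf')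
  \<comment> \<open>Zero mean kills the cross term; the extra square is nonnegative and is discarded
    at the end.\<close>
  also have "integral {0..1} (\<lambda>x. (h x)\<^sup>2) = integral {0..1} (\<lambda>x. (f x)\<^sup>2) + (f a)\<^sup>2"
  proof -
    have "((\<lambda>x. (f x)\<^sup>2 - 2 * f a * f x + (f a)\<^sup>2) has_integral
        integral {0..1} (\<lambda>x. (f x)\<^sup>2) - 2 * f a * integral {0..1} f + (f a)\<^sup>2) {0..1}"
      using has_integral_const_real[of "(f a)\<^sup>2" 0 1]
      by (intro has_integral_add has_integral_diff has_integral_mult_right integrable_integral
          integrable_continuous_real continuous_intros cf) simp
    then show ?thesis
      by (simp add: mean h_def power2_diff mult_ac integral_unique algebra_simps)
  qed
  finally have "4 * pi\<^sup>2 * (integral {0..1} (\<lambda>x. (f x)\<^sup>2) + (f a)\<^sup>2) \<le> integral {0..1} (\<lambda>x. (f' x)\<^sup>2)" .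
  moreover have "0 \<le> 4 * pi\<^sup>2 * (f a)\<^sup>2" by simp
  ultimately show ?thesis by (simp only: distrib_left)
qed

text \<open>The function is split into its mean m(y) over the first variable and the rest. For each
  y the rest has mean zero and is controlled by \<open>ux\<close>; the function m is itself periodic
  of mean zero and is controlled by m', whose square is at most the fibre mean of \<open>uy\<close>
  squared.\<close>

lemma wirtinger_square:
  fixes u ux uy :: "real \<Rightarrow> real \<Rightarrow> real"
  assumes dx: "\<And>x y. ((\<lambda>x. u x y) has_real_derivative ux x y) (at x)"
    and dy: "\<And>x y. (u x has_real_derivative uy x y) (at y)"
    and cu: "continuous_on UNIV (\<lambda>(x, y). u x y)"
    and cx: "continuous_on UNIV (\<lambda>(x, y). ux x y)"
    and cy: "continuous_on UNIV (\<lambda>(x, y). uy x y)"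
    and px: "\<And>x y. u (x + 1) y = u x y" and py: "\<And>x y. u x (y + 1) = u x y"
    and mean: "integral {0..1} (\<lambda>y. integral {0..1} (\<lambda>x. u x y)) = 0"
  shows "4 * pi\<^sup>2 * integral {0..1} (\<lambda>y. integral {0..1} (\<lambda>x. (u x y)\<^sup>2)) \<le>
    integral {0..1} (\<lambda>y. integral {0..1} (\<lambda>x. (ux x y)\<^sup>2)) +
    integral {0..1} (\<lambda>y. integral {0..1} (\<lambda>x. (uy x y)\<^sup>2))"
proof -
  have cont: "continuous_on A (\<lambda>z. f (a z) (b z))"
    if "continuous_on UNIV (\<lambda>(x, y). f x y)" "continuous_on A a" "continuous_on A b"
    for f :: "real \<Rightarrow> real \<Rightarrow> real" and a b :: "'z::topological_space \<Rightarrow> real" and A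
    using continuous_on_compose2[OF that(1) continuous_on_Pair[OF that(2,3)]] by simp
  have cont1: "continuous_on A (\<lambda>x. f x y)" "continuous_on B (f x)"
    if "continuous_on UNIV (\<lambda>(x, y). f x y)"
    for f :: "real \<Rightarrow> real \<Rightarrow> real" and A B x y
    by (intro cont[OF that] continuous_intros)+
  have cint: "continuous_on A (\<lambda>y. integral {0..1} (\<lambda>x. f x y))"
    if "continuous_on UNIV (\<lambda>(x, y). f x y)" for f :: "real \<Rightarrow> real \<Rightarrow> real" and A
  proof -
    have "continuous_on (A \<times> cbox 0 1) (\<lambda>(y, x). f x y)"
      unfolding case_prod_beta by (intro cont[OF that] continuous_intros)
    from integral_continuous_on_param[OF this] show ?thesis by simp
  qed
  have csq: "continuous_on UNIV (\<lambda>(x, y). (f x y)\<^sup>2)"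
    if "continuous_on UNIV (\<lambda>(x, y). f x y)" for f :: "real \<Rightarrow> real \<Rightarrow> real"
    using continuous_on_power[OF that, of 2] by (simp add: case_prod_beta)
  define m where "m y = integral {0..1} (\<lambda>x. u x y)" for y
  define m' where "m' y = integral {0..1} (\<lambda>x. uy x y)" for y
  have variance: "((\<lambda>x. (f x - c)\<^sup>2) has_integral integral {0..1} (\<lambda>x. (f x)\<^sup>2) - c\<^sup>2) {0..1}"
    if "continuous_on UNIV f" "integral {0..1} f = c" for f :: "real \<Rightarrow> real" and c
  proof -
    have "((\<lambda>x. (f x)\<^sup>2 - 2 * c * f x + c\<^sup>2) has_integral
        integral {0..1} (\<lambda>x. (f x)\<^sup>2) - 2 * c * integral {0..1} f + c\<^sup>2) {0..1}"
      using has_integral_const_real[of "c\<^sup>2" 0 1]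
      by (intro has_integral_add has_integral_diff has_integral_mult_right integrable_integral
          integrable_continuous_real continuous_intros continuous_on_subset[OF that(1)]) auto
    then show ?thesis by (simp add: that(2) power2_diff power2_eq_square algebra_simps)
  qed
  have dm: "(m has_real_derivative m' y) (at y)" for y
  proof -
    have "((\<lambda>y. integral (cbox 0 1) (\<lambda>x. u x y)) has_field_derivative integral (cbox 0 1) (\<lambda>x. uy x y)) (at y within UNIV)"
    proof (rule leibniz_rule_field_derivative)
      show "((\<lambda>y. u x y) has_field_derivative uy x y) (at y within UNIV)" for y x
        using dy by simp
      show "(\<lambda>x. u x y) integrable_on cbox 0 1" for y
        using cont1(1)[OF cu] by (intro integrable_continuous) auto
      show "continuous_on (UNIV \<times> cbox 0 1) (\<lambda>(y, x). uy x y)"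
        unfolding case_prod_beta by (intro cont[OF cy] continuous_intros)
    qed auto
    then show ?thesis by (simp add: m_def[abs_def] m'_def)
  qed
  have m_mean: "integral {0..1} m = 0" using mean by (simp add: m_def[abs_def])
  have cm': "continuous_on UNIV m'" unfolding m'_def using cint[OF cy] by simp
  have cm: "continuous_on A m" for A unfolding m_def using cint[OF cu] by simp
  have "4 * pi\<^sup>2 * (integral {0..1} (\<lambda>x. (u x y)\<^sup>2) - (m y)\<^sup>2) \<le> integral {0..1} (\<lambda>x. (ux x y)\<^sup>2)" for y
  proof -
    have "((\<lambda>x. u x y - m y) has_integral (m y - m y)) {0..1}"
      using has_integral_const_real[of "m y" 0 1] cont1(1)[OF cu] unfolding m_def
      by (intro has_integral_diff integrable_integral integrable_continuous_real) auto
    then have "integral {0..1} (\<lambda>x. u x y - m y) = 0"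
      by (simp add: integral_unique)
    moreover have "((\<lambda>x. u x y - m y) has_real_derivative ux x y) (at x)" for x
      using DERIV_diff[OF dx DERIV_const] by simp
    ultimately have "4 * pi\<^sup>2 * integral {0..1} (\<lambda>x. (u x y - m y)\<^sup>2) \<le> integral {0..1} (\<lambda>x. (ux x y)\<^sup>2)"
      using cont1(1)[OF cx] by (intro wirtinger_periodic) (auto simp: px)
    moreover have "integral {0..1} (\<lambda>x. (u x y - m y)\<^sup>2) = integral {0..1} (\<lambda>x. (u x y)\<^sup>2) - (m y)\<^sup>2"
      by (rule integral_unique[OF variance]) (auto simp: m_def cont1(1)[OF cu])
    ultimately show ?thesis by simp
  qed
  note le = this
  have "((\<lambda>y. 4 * pi\<^sup>2 * (integral {0..1} (\<lambda>x. (u x y)\<^sup>2) - (m y)\<^sup>2)) has_integral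
      4 * pi\<^sup>2 * (integral {0..1} (\<lambda>y. integral {0..1} (\<lambda>x. (u x y)\<^sup>2)) - integral {0..1} (\<lambda>y. (m y)\<^sup>2))) {0..1}"
    by (intro has_integral_mult_right has_integral_diff integrable_integral integrable_continuous_real
        continuous_intros cm cint csq cu)
  moreover have "((\<lambda>y. integral {0..1} (\<lambda>x. (ux x y)\<^sup>2)) has_integral
      integral {0..1} (\<lambda>y. integral {0..1} (\<lambda>x. (ux x y)\<^sup>2))) {0..1}"
    by (intro integrable_integral integrable_continuous_real cint csq cx)
  ultimately have 1: "4 * pi\<^sup>2 * (integral {0..1} (\<lambda>y. integral {0..1} (\<lambda>x. (u x y)\<^sup>2)) - integral {0..1} (\<lambda>y. (m y)\<^sup>2))
      \<le> integral {0..1} (\<lambda>y. integral {0..1} (\<lambda>x. (ux x y)\<^sup>2))"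
    using le by (rule has_integral_le)
  have "m (y + 1) = m y" for y by (simp add: m_def py)
  then have 2: "4 * pi\<^sup>2 * integral {0..1} (\<lambda>y. (m y)\<^sup>2) \<le> integral {0..1} (\<lambda>y. (m' y)\<^sup>2)"
    by (intro wirtinger_periodic dm cm' m_mean)
  \<comment> \<open>Nonnegativity of the variance of \<open>uy\<close> along the fibre.\<close>
  have "(m' y)\<^sup>2 \<le> integral {0..1} (\<lambda>x. (uy x y)\<^sup>2)" for y
    using has_integral_nonneg[OF variance[OF cont1(1)[OF cy] m'_def[symmetric]]] by simp
  then have 3: "integral {0..1} (\<lambda>y. (m' y)\<^sup>2) \<le> integral {0..1} (\<lambda>y. integral {0..1} (\<lambda>x. (uy x y)\<^sup>2))"
    by (intro integral_le integrable_continuous_real cint csq cy continuous_intros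
        continuous_on_subset[OF cm' subset_UNIV])
  from 1 2 3 show ?thesis by (simp add: right_diff_distrib)
qed

section \<open>Iterated integrals over the unit square\<close>

lemma vector_2_axis: "(vector [x, y] :: real^2) = x *\<^sub>R axis 1 1 + y *\<^sub>R axis 2 1"
  by (simp add: vec_eq_iff forall_2 axis_def)

lemma vector_2_nth: "(vector [z $ 1, z $ 2] :: real^2) = z"
  by (simp add: vec_eq_iff forall_2)

lemma continuous_on_vector_2:
  assumes "continuous_on A a" "continuous_on A b"
  shows "continuous_on A (\<lambda>z. vector [a z, b z] :: real^2)"
  unfolding vector_2_axis by (intro continuous_intros assms)

text \<open>Both coordinate maps between pairs and \<open>real^2\<close> carry boxes to boxes of the
  same content, so the integral is transported with factor 1. This opens the way to Fubini for
  pairs.\<close>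

lemma integral_square_pair:
  fixes f :: "real^2 \<Rightarrow> real"
  assumes "continuous_on UNIV f"
  shows "integral (cbox 0 1) f = integral (cbox (0, 0) (1, 1)) (\<lambda>(x, y). f (vector [x, y]))"
proof -
  define g :: "real \<times> real \<Rightarrow> real^2" where "g = (\<lambda>(x, y). vector [x, y])"
  define h :: "real^2 \<Rightarrow> real \<times> real" where "h z = (z $ 1, z $ 2)" for z
  have hg: "h (g z) = z" for z by (auto simp: h_def g_def split: prod.split)
  have gh: "g (h z) = z" for z by (simp add: h_def g_def vector_2_nth)
  have g_box: "g ` cbox u v = cbox (g u) (g v)" for u v
  proof
    show "g ` cbox u v \<subseteq> cbox (g u) (g v)"
      by (auto simp: g_def mem_box_cart forall_2 cbox_Pair_eq split: prod.split)
    show "cbox (g u) (g v) \<subseteq> g ` cbox u v"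
    proof
      fix z assume "z \<in> cbox (g u) (g v)"
      then have "h z \<in> cbox u v"
        by (cases u; cases v) (auto simp: g_def h_def mem_box_cart forall_2 cbox_Pair_eq)
      then show "z \<in> g ` cbox u v" using gh[of z] by (metis imageI)
    qed
  qed
  have h_box: "h ` cbox u v = cbox (h u) (h v)" for u v
    unfolding g_box[of "h u" "h v", unfolded gh, symmetric] image_image hg by simp
  have int: "f integrable_on cbox 0 1"
    by (intro integrable_continuous continuous_on_subset[OF assms] subset_UNIV)
  have "((\<lambda>z. f (g z)) has_integral (1 / 1) *\<^sub>R integral (cbox 0 1) f) (h ` cbox 0 1)"
  proof (rule has_integral_twiddle[OF _ hg gh])
    show "continuous (at z) g" for z
    proof -
      have "continuous_on UNIV g"
        unfolding g_def case_prod_beta by (intro continuous_on_vector_2 continuous_intros)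
      then show ?thesis using continuous_on_eq_continuous_at[OF open_UNIV] by blast
    qed
    show "measure lborel (g ` cbox u v) = 1 * measure lborel (cbox u v)" for u v
    proof (cases "cbox u v = {}")
      case False
      then have ne: "cbox (g u) (g v) \<noteq> {}" using g_box[of u v] by blast
      obtain a b c d where uv: "u = (a, b)" "v = (c, d)" by (cases u; cases v)
      have "cbox a c \<noteq> {}" "cbox b d \<noteq> {}" using False by (auto simp: uv cbox_Pair_eq)
      then show ?thesis unfolding g_box content_cbox_cart[OF ne]
        by (simp add: uv content_Pair g_def UNIV_2)
    qed (simp add: g_box)
    show "\<exists>w z. g ` cbox u v = cbox w z" for u v using g_box by blast
    show "\<exists>w z. h ` cbox u v = cbox w z" for u v using h_box by blast
  qed (use integrable_integral[OF int] in auto)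
  then have "((\<lambda>z. f (g z)) has_integral integral (cbox 0 1) f) (cbox (0, 0) (1, 1))"
    unfolding h_box by (simp add: h_def)
  from integral_unique[OF this, symmetric] show ?thesis unfolding g_def case_prod_beta .
qed

lemma integral_square_iterated:
  fixes f :: "real^2 \<Rightarrow> real"
  assumes "continuous_on UNIV f"
  shows "integral (cbox 0 1) f = integral {0..1} (\<lambda>x. integral {0..1} (\<lambda>y. f (vector [x, y])))"
    and "integral (cbox 0 1) f = integral {0..1} (\<lambda>y. integral {0..1} (\<lambda>x. f (vector [x, y])))"
proof -
  have c: "continuous_on (cbox (0, 0) (1, 1)) (\<lambda>(x, y). f (vector [x, y]))"
    unfolding case_prod_beta
    by (intro continuous_on_compose2[OF assms] continuous_on_vector_2 continuous_intros) auto
  show 1: "integral (cbox 0 1) f = integral {0..1} (\<lambda>x. integral {0..1} (\<lambda>y. f (vector [x, y])))"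
    using integral_prod_continuous[OF c] by (simp add: integral_square_pair[OF assms])
  show "integral (cbox 0 1) f = integral {0..1} (\<lambda>y. integral {0..1} (\<lambda>x. f (vector [x, y])))"
    unfolding 1 using integral_swap_continuous[OF c] by simp
qed

lemma DERIV_partial:
  fixes u :: "real^2 \<Rightarrow> real"
  assumes "\<And>x. u differentiable (at x)"
  shows "((\<lambda>x. u (vector [x, y])) has_real_derivative partial 1 u (vector [x, y])) (at x)"
    and "((\<lambda>y. u (vector [x, y])) has_real_derivative partial 2 u (vector [x, y])) (at y)"
proof -
  have u: "(u has_derivative frechet_derivative u (at z)) (at z)" for z
    using assms frechet_derivative_works by blast
  have lin: "linear (frechet_derivative u (at z))" for z
    using assms linear_frechet_derivative by blast
  have "((\<lambda>x. vector [x, y] :: real^2) has_derivative (\<lambda>v. v *\<^sub>R axis 1 1)) (at x)"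
    unfolding vector_2_axis by (rule derivative_eq_intros refl)+ simp
  from has_derivative_compose[OF this u]
  show "((\<lambda>x. u (vector [x, y])) has_real_derivative partial 1 u (vector [x, y])) (at x)"
    unfolding has_field_derivative_def
    by (rule has_derivative_eq_rhs) (auto simp: fun_eq_iff partial_def linear_scale[OF lin])
  have "((\<lambda>y. vector [x, y] :: real^2) has_derivative (\<lambda>v. v *\<^sub>R axis 2 1)) (at y)"
    unfolding vector_2_axis by (rule derivative_eq_intros refl)+ simp
  from has_derivative_compose[OF this u]
  show "((\<lambda>y. u (vector [x, y])) has_real_derivative partial 2 u (vector [x, y])) (at y)"
    unfolding has_field_derivative_def
    by (rule has_derivative_eq_rhs) (auto simp: fun_eq_iff partial_def linear_scale[OF lin])
qed

lemma doubly_periodic_vector: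
  assumes "doubly_periodic u"
  shows "u (vector [x + 1, y]) = u (vector [x, y])" "u (vector [x, y + 1]) = u (vector [x, y])"
proof -
  have "(vector [x + 1, y] :: real^2) = vector [x, y] + axis 1 1"
    "(vector [x, y + 1] :: real^2) = vector [x, y] + axis 2 1"
    by (simp_all add: vector_2_axis algebra_simps)
  then show "u (vector [x + 1, y]) = u (vector [x, y])" "u (vector [x, y + 1]) = u (vector [x, y])"
    using assms by (simp_all add: doubly_periodic_def)
qed

text \<open>Integrating in the variable \<open>i\<close> first gives a difference of two equal
  values; hence both orders of iterated integration occur.\<close>

lemma integral_square_partial:
  fixes u :: "real^2 \<Rightarrow> real"
  assumes diff: "\<And>x. u differentiable (at x)" and cont: "continuous_on UNIV (partial i u)"
    and per: "doubly_periodic u"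
  shows "integral (cbox 0 1) (partial i u) = 0"
proof (cases "i = 1")
  case True
  have "integral {0..1} (\<lambda>x. partial 1 u (vector [x, y])) = 0" for y
    using doubly_periodic_vector(1)[OF per, of 0 y]
    by (intro integral_unique has_integral_periodic_derivative[OF DERIV_partial(1)[OF diff]]) simp
  then show ?thesis using cont by (simp add: True integral_square_iterated(2))
next
  case False
  then have i: "i = 2" using exhaust_2 by auto
  have "integral {0..1} (\<lambda>y. partial 2 u (vector [x, y])) = 0" for x
    using doubly_periodic_vector(2)[OF per, of x 0]
    by (intro integral_unique has_integral_periodic_derivative[OF DERIV_partial(2)[OF diff]]) simp
  then show ?thesis using cont by (simp add: i integral_square_iterated(1))
qed

lemma wirtinger_torus:
  fixes u :: "real^2 \<Rightarrow> real"
  assumes diff: "\<And>x. u differentiable (at x)" and cont: "\<And>i. continuous_on UNIV (partial i u)"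
    and per: "doubly_periodic u" and mean: "integral (cbox 0 1) u = 0"
  shows "4 * pi\<^sup>2 * integral (cbox 0 1) (\<lambda>x. (u x)\<^sup>2)
    \<le> integral (cbox 0 1) (\<lambda>x. (partial 1 u x)\<^sup>2 + (partial 2 u x)\<^sup>2)"
proof -
  have cu: "continuous_on UNIV u"
    using diff by (auto intro!: continuous_at_imp_continuous_on differentiable_imp_continuous_within)
  have c: "continuous_on UNIV (\<lambda>(x, y). f (vector [x, y]))" if "continuous_on UNIV f" for f :: "real^2 \<Rightarrow> real"
    unfolding case_prod_beta
    by (intro continuous_on_compose2[OF that] continuous_on_vector_2 continuous_intros) auto
  have "integral (cbox 0 1) (\<lambda>x. (partial 1 u x)\<^sup>2 + (partial 2 u x)\<^sup>2) =
    integral (cbox 0 1) (\<lambda>x. (partial 1 u x)\<^sup>2) + integral (cbox 0 1) (\<lambda>x. (partial 2 u x)\<^sup>2)"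
    by (intro Henstock_Kurzweil_Integration.integral_add integrable_continuous continuous_intros
        continuous_on_subset[OF cont] subset_UNIV)
  moreover have "4 * pi\<^sup>2 * integral {0..1} (\<lambda>y. integral {0..1} (\<lambda>x. (u (vector [x, y]))\<^sup>2)) \<le>
    integral {0..1} (\<lambda>y. integral {0..1} (\<lambda>x. (partial 1 u (vector [x, y]))\<^sup>2)) +
    integral {0..1} (\<lambda>y. integral {0..1} (\<lambda>x. (partial 2 u (vector [x, y]))\<^sup>2))"
    using mean unfolding integral_square_iterated(2)[OF cu]
    by (intro wirtinger_square[OF DERIV_partial[OF diff]] c cu cont doubly_periodic_vector[OF per])
  ultimately show ?thesis
    by (simp add: integral_square_iterated(2) continuous_on_power cu cont)
qed

section \<open>Functions on the flat torus\<close>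

lemma doubly_periodic_int:
  assumes "doubly_periodic u"
  shows "u (x + of_int n *\<^sub>R axis i 1) = u x"
proof -
  have nat: "u (x + of_nat n *\<^sub>R axis i 1) = u x" for x n
  proof (induction n)
    case (Suc n)
    have "x + of_nat (Suc n) *\<^sub>R axis i 1 = (x + of_nat n *\<^sub>R axis i 1) + axis i 1"
      by (simp add: scaleR_add_left add_ac)
    then show ?case using Suc assms by (simp only: doubly_periodic_def)
  qed simp
  show ?thesis
  proof (cases "n \<ge> 0")
    case True
    then show ?thesis using nat[of x "nat n"] by simp
  next
    case False
    then show ?thesis using nat[of "x + of_int n *\<^sub>R axis i 1" "nat (- n)"] by simp
  qed
qed

lemma doubly_periodic_reduce:
  assumes "doubly_periodic u"
  obtains y where "y \<in> cbox 0 (1 :: real^2)" "u x = u y"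
proof
  let ?y = "vector [frac (x $ 1), frac (x $ 2)] :: real^2"
  show "?y \<in> cbox 0 1"
    by (simp add: mem_box_cart forall_2 frac_lt_1 less_imp_le)
  have "x = (?y + of_int \<lfloor>x $ 1\<rfloor> *\<^sub>R axis 1 1) + of_int \<lfloor>x $ 2\<rfloor> *\<^sub>R axis 2 1"
    by (simp add: vec_eq_iff forall_2 axis_def frac_def)
  then show "u x = u ?y"
    using doubly_periodic_int[OF assms] by metis
qed

text \<open>Green's identities on the torus: the integrals of the derivatives of
  \<open>u * partial i u\<close> and of \<open>partial i u\<close> vanish by periodicity.\<close>

lemma integral_square_energy:
  fixes u :: "real^2 \<Rightarrow> real"
  assumes u: "smooth_on UNIV u" and per: "doubly_periodic u"
  shows "integral (cbox 0 1) (\<lambda>x. u x * (\<Sum>i\<in>UNIV. partial i (partial i u) x)) =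
    - integral (cbox 0 1) (\<lambda>x. (partial 1 u x)\<^sup>2 + (partial 2 u x)\<^sup>2)"
    and "integral (cbox 0 1) (\<lambda>x. \<Sum>i\<in>UNIV. partial i (partial i u) x) = 0"
proof -
  note [continuous_intros] = continuous_on_subset[OF smooth_on_continuous[OF u] subset_UNIV]
    continuous_on_subset[OF smooth_on_continuous[OF smooth_on_partial[OF u]] subset_UNIV]
    continuous_on_subset[OF smooth_on_continuous[OF smooth_on_partial[OF smooth_on_partial[OF u]]] subset_UNIV]
  have p: "partial i (\<lambda>x. u x * partial i u x) x = (partial i u x)\<^sup>2 + u x * partial i (partial i u) x" for i x
  proof -
    have "((\<lambda>x. u x * partial i u x) has_derivative
      (\<lambda>v. u x * frechet_derivative (partial i u) (at x) v + frechet_derivative u (at x) v * partial i u x)) (at x)"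
      using smooth_on_differentiable[OF u] smooth_on_differentiable[OF smooth_on_partial[OF u]]
      by (intro has_derivative_mult) (auto simp flip: frechet_derivative_works)
    from partial_eqI[OF this] show ?thesis by (simp add: partial_def[symmetric] power2_eq_square)
  qed
  have 1: "integral (cbox 0 1) (\<lambda>x. (partial i u x)\<^sup>2 + u x * partial i (partial i u) x) = 0" for i
    unfolding p[symmetric]
  proof (rule integral_square_partial)
    show "(\<lambda>x. u x * partial i u x) differentiable at x" for x
      using smooth_on_differentiable[OF u] smooth_on_differentiable[OF smooth_on_partial[OF u]]
      by (intro differentiable_mult) auto
    show "continuous_on UNIV (partial i (\<lambda>x. u x * partial i u x))"
      unfolding p[abs_def] by (intro continuous_intros)
    show "doubly_periodic (\<lambda>x. u x * partial i u x)"
      using per doubly_periodic_partial[OF per] by (simp add: doubly_periodic_def)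
  qed
  have "((\<lambda>x. ((partial 1 u x)\<^sup>2 + u x * partial 1 (partial 1 u) x) + ((partial 2 u x)\<^sup>2 + u x * partial 2 (partial 2 u) x))
     has_integral 0 + 0) (cbox 0 1)"
  proof (rule has_integral_add)
    have I: "((\<lambda>x. (partial i u x)\<^sup>2 + u x * partial i (partial i u) x) has_integral 0) (cbox 0 1)" for i
      unfolding 1[of i, symmetric]
      by (intro integrable_integral integrable_continuous continuous_intros)
    show "((\<lambda>x. (partial 1 u x)\<^sup>2 + u x * partial 1 (partial 1 u) x) has_integral 0) (cbox 0 1)"
      by (rule I)
    show "((\<lambda>x. (partial 2 u x)\<^sup>2 + u x * partial 2 (partial 2 u) x) has_integral 0) (cbox 0 1)"
      by (rule I)
  qed
  moreover have "((\<lambda>x. (partial 1 u x)\<^sup>2 + (partial 2 u x)\<^sup>2) has_integral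
      integral (cbox 0 1) (\<lambda>x. (partial 1 u x)\<^sup>2 + (partial 2 u x)\<^sup>2)) (cbox 0 1)"
    by (intro integrable_integral integrable_continuous continuous_intros)
  ultimately have "((\<lambda>x. (((partial 1 u x)\<^sup>2 + u x * partial 1 (partial 1 u) x) + ((partial 2 u x)\<^sup>2 + u x * partial 2 (partial 2 u) x))
      - ((partial 1 u x)\<^sup>2 + (partial 2 u x)\<^sup>2)) has_integral
    (0 + 0 - integral (cbox 0 1) (\<lambda>x. (partial 1 u x)\<^sup>2 + (partial 2 u x)\<^sup>2))) (cbox 0 1)"
    by (rule has_integral_diff)
  moreover have "(\<lambda>x. (((partial 1 u x)\<^sup>2 + u x * partial 1 (partial 1 u) x) + ((partial 2 u x)\<^sup>2 + u x * partial 2 (partial 2 u) x))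
      - ((partial 1 u x)\<^sup>2 + (partial 2 u x)\<^sup>2)) = (\<lambda>x. u x * (\<Sum>i\<in>UNIV. partial i (partial i u) x))"
    by (simp add: fun_eq_iff sum_2 distrib_left)
  ultimately have "((\<lambda>x. u x * (\<Sum>i\<in>UNIV. partial i (partial i u) x)) has_integral
    (0 + 0 - integral (cbox 0 1) (\<lambda>x. (partial 1 u x)\<^sup>2 + (partial 2 u x)\<^sup>2))) (cbox 0 1)"
    by simp
  then show "integral (cbox 0 1) (\<lambda>x. u x * (\<Sum>i\<in>UNIV. partial i (partial i u) x)) =
    - integral (cbox 0 1) (\<lambda>x. (partial 1 u x)\<^sup>2 + (partial 2 u x)\<^sup>2)"
    by (simp add: integral_unique)
  have "integral (cbox 0 1) (partial i (partial i u)) = 0" for i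
    using smooth_on_differentiable[OF smooth_on_partial[OF u]] doubly_periodic_partial[OF per]
      smooth_on_continuous[OF smooth_on_partial[OF smooth_on_partial[OF u]]]
    by (intro integral_square_partial) auto
  then show "integral (cbox 0 1) (\<lambda>x. \<Sum>i\<in>UNIV. partial i (partial i u) x) = 0"
    unfolding sum_2
    by (subst Henstock_Kurzweil_Integration.integral_add)
      (auto intro!: integrable_continuous continuous_intros)
qed

lemma integral_square_variance:
  fixes u :: "real^2 \<Rightarrow> real"
  assumes "continuous_on UNIV u"
  shows "integral (cbox 0 1) (\<lambda>x. u x - c) = integral (cbox 0 1) u - c"
    and "integral (cbox 0 1) (\<lambda>x. (u x - c)\<^sup>2) =
      integral (cbox 0 1) (\<lambda>x. (u x)\<^sup>2) - 2 * c * integral (cbox 0 1) u + c\<^sup>2"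
proof -
  note [continuous_intros] = continuous_on_subset[OF assms subset_UNIV]
  have "(0 :: real^2) \<in> cbox 0 1" by (simp add: mem_box_cart)
  then have "cbox 0 (1 :: real^2) \<noteq> {}" by blast
  from content_cbox_cart[OF this] have "measure lborel (cbox 0 (1 :: real^2)) = 1" by simp
  then have const: "((\<lambda>x. k) has_integral k) (cbox 0 (1 :: real^2))" for k :: real
    using has_integral_const[of k 0 "1 :: real^2"] by simp
  have int: "(u has_integral integral (cbox 0 1) u) (cbox 0 1)"
    "((\<lambda>x. (u x)\<^sup>2) has_integral integral (cbox 0 1) (\<lambda>x. (u x)\<^sup>2)) (cbox 0 1)"
    by (intro integrable_integral integrable_continuous continuous_intros)+
  show "integral (cbox 0 1) (\<lambda>x. u x - c) = integral (cbox 0 1) u - c"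
    by (rule integral_unique[OF has_integral_diff[OF int(1) const]])
  have "((\<lambda>x. (u x)\<^sup>2 - 2 * c * u x + c\<^sup>2) has_integral
     integral (cbox 0 1) (\<lambda>x. (u x)\<^sup>2) - 2 * c * integral (cbox 0 1) u + c\<^sup>2) (cbox 0 1)"
    by (intro has_integral_add has_integral_diff has_integral_mult_right int const)
  moreover have "(\<lambda>x. (u x - c)\<^sup>2) = (\<lambda>x. (u x)\<^sup>2 - 2 * c * u x + c\<^sup>2)"
    by (simp add: fun_eq_iff power2_diff)
  ultimately show "integral (cbox 0 1) (\<lambda>x. (u x - c)\<^sup>2) =
      integral (cbox 0 1) (\<lambda>x. (u x)\<^sup>2) - 2 * c * integral (cbox 0 1) u + c\<^sup>2"
    by (simp add: integral_unique)
qed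

text \<open>Green's identity turns Wirtinger's inequality for v = u - m into 4 pi^2 \<integral>v^2
  \<le> l \<integral>u^2 = l \<integral>v^2, so v = 0. The sign of \<open>l\<close> is free, which
  covers all negative eigenvalues of the Jacobi operator together.\<close>

lemma torus_eigenfunction_constant:
  fixes u :: "real^2 \<Rightarrow> real"
  assumes u: "smooth_on UNIV u" and per: "doubly_periodic u"
    and eigen: "\<And>x. (\<Sum>i\<in>UNIV. partial i (partial i u) x) = - l * u x" and "l < 4 * pi\<^sup>2"
  shows "\<exists>m. u = (\<lambda>x. m)"
proof -
  define m where "m = integral (cbox 0 1) u"
  have cu: "continuous_on A u" for A
    using continuous_on_subset[OF smooth_on_continuous[OF u] subset_UNIV] .
  let ?v = "\<lambda>x. u x - m"
  have "4 * pi\<^sup>2 * integral (cbox 0 1) (\<lambda>x. (?v x)\<^sup>2)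
      \<le> integral (cbox 0 1) (\<lambda>x. (partial 1 ?v x)\<^sup>2 + (partial 2 ?v x)\<^sup>2)"
  proof (rule wirtinger_torus)
    show "?v differentiable at x" for x
      using smooth_on_differentiable[OF u] by (intro differentiable_diff) auto
    show "continuous_on UNIV (partial i ?v)" for i
      unfolding partial_diff_const[OF smooth_on_differentiable[OF u]] using smooth_on_continuous[OF smooth_on_partial[OF u]] .
    show "doubly_periodic ?v" using per by (simp add: doubly_periodic_def)
    show "integral (cbox 0 1) ?v = 0" by (simp add: integral_square_variance(1)[OF cu] m_def)
  qed
  also have "\<dots> = - integral (cbox 0 1) (\<lambda>x. u x * (- l * u x))"
    using integral_square_energy(1)[OF u per] unfolding partial_diff_const[OF smooth_on_differentiable[OF u]] eigen by simp
  also have "\<dots> = l * integral (cbox 0 1) (\<lambda>x. (u x)\<^sup>2)"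
    by (simp add: power2_eq_square mult.left_commute)
  also have "l * integral (cbox 0 1) (\<lambda>x. (u x)\<^sup>2) = l * integral (cbox 0 1) (\<lambda>x. (?v x)\<^sup>2)"
  proof -
    \<comment> \<open>The integrated equation makes either \<open>l\<close> or the mean zero; either
      way \<open>l\<close> times the integral is unaffected by subtracting the mean.\<close>
    have "l * m = 0"
      using integral_square_energy(2)[OF u per] unfolding eigen by (simp add: m_def)
    then show ?thesis
      unfolding integral_square_variance(2)[OF cu] m_def[symmetric] by auto
  qed
  finally have "(4 * pi\<^sup>2 - l) * integral (cbox 0 1) (\<lambda>x. (?v x)\<^sup>2) \<le> 0"
    by (simp add: left_diff_distrib)
  then have "integral (cbox 0 1) (\<lambda>x. (?v x)\<^sup>2) \<le> 0"
    using \<open>l < 4 * pi\<^sup>2\<close> by (simp add: mult_le_0_iff)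
  moreover have "0 \<le> integral (cbox 0 1) (\<lambda>x. (?v x)\<^sup>2)"
    by (intro integral_nonneg integrable_continuous continuous_intros cu) simp
  ultimately have "integral (cbox 0 1) (\<lambda>x. (?v x)\<^sup>2) = 0" by simp
  moreover have "box 0 (1 :: real^2) \<noteq> {}"
    by (auto simp: box_ne_empty Basis_vec_def inner_axis)
  \<comment> \<open>A continuous nonnegative function with integral 0 vanishes on the closed square;
    periodicity carries this to the plane.\<close>
  ultimately have "\<forall>x\<in>cbox 0 1. (?v x)\<^sup>2 = 0"
    by (subst (asm) integral_cbox_eq_0_iff) (auto intro!: continuous_intros cu)
  then have "u x = m" for x
    using doubly_periodic_reduce[OF per, of x] by (metis eq_iff_diff_eq_0 zero_eq_power2)
  then show ?thesis by blast
qed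

section \<open>Index and stability of the Clifford torus\<close>

lemma sqrt_det_mat_2: "0 \<le> c \<Longrightarrow> sqrt (det (mat c :: real^2^2)) = c"
  by (simp add: det_2 mat_def)

lemma matrix_inv_mat_quadratic:
  assumes "c \<noteq> (0::real)"
  shows "(\<Sum>i\<in>UNIV. \<Sum>j\<in>UNIV. matrix_inv (mat c :: real^2^2) $ i $ j * a i * a j) = ((a 1)\<^sup>2 + (a 2)\<^sup>2) / c"
proof -
  have "(\<Sum>i\<in>UNIV. \<Sum>j\<in>UNIV. matrix_inv (mat c :: real^2^2) $ i $ j * a i * a j) =
      inverse c * (a 1 * a 1) + inverse c * (a 2 * a 2)"
    by (simp add: matrix_inv_mat_nth[OF assms] sum_2)
  then show ?thesis
    by (simp only: divide_inverse power2_eq_square distrib_right) (simp only: mult.commute)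
qed

text \<open>In dimension two the area density c cancels the inverse metric 1/c inside the
  divergence, leaving only the outer 1/c.\<close>

lemma laplace_beltrami_clifford:
  "laplace_beltrami (first_fundamental conf_metric clifford) u x =
    (\<Sum>i\<in>UNIV. partial i (partial i u) x) / (2 * pi\<^sup>2)"
proof -
  have "(\<lambda>y. sqrt (det (mat (2 * pi\<^sup>2) :: real^2^2)) *
      (\<Sum>j\<in>UNIV. matrix_inv (mat (2 * pi\<^sup>2) :: real^2^2) $ i $ j * partial j u y)) = partial i u" for i :: 2
    using exhaust_2[of i] by (auto simp: fun_eq_iff sqrt_det_mat_2 matrix_inv_mat_nth sum_2)
  then show ?thesis
    unfolding laplace_beltrami_def first_fundamental_clifford by (simp add: sqrt_det_mat_2)
qed

lemma area_integral_clifford: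
  "area_integral conf_metric clifford u = 2 * pi\<^sup>2 * integral (cbox 0 1) u"
  by (simp add: area_integral_def first_fundamental_clifford sqrt_det_mat_2 mult.commute)

text \<open>The Dirichlet energy does not see the constant metric factor, while the potential 2
  times the area density 2 pi^2 gives 4 pi^2, exactly Wirtinger's constant.\<close>

lemma stability_form_clifford:
  fixes u :: "real^2 \<Rightarrow> real"
  assumes u: "smooth_on UNIV u"
  shows "stability_form conf_metric clifford clifford_normal u =
    integral (cbox 0 1) (\<lambda>x. (partial 1 u x)\<^sup>2 + (partial 2 u x)\<^sup>2) - 4 * pi\<^sup>2 * integral (cbox 0 1) (\<lambda>x. (u x)\<^sup>2)"
proof -
  note [continuous_intros] = continuous_on_subset[OF smooth_on_continuous[OF u] subset_UNIV]
    continuous_on_subset[OF smooth_on_continuous[OF smooth_on_partial[OF u]] subset_UNIV]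
  have "stability_form conf_metric clifford clifford_normal u =
    integral (cbox 0 1) (\<lambda>x. 2 * pi\<^sup>2 * (((partial 1 u x)\<^sup>2 + (partial 2 u x)\<^sup>2) / (2 * pi\<^sup>2) - 2 * (u x)\<^sup>2))"
    unfolding stability_form_def area_integral_clifford grad_norm_sq_def first_fundamental_clifford jacobi_potential_clifford
      integral_mult_right by (subst matrix_inv_mat_quadratic) simp_all
  also have "(\<lambda>x. 2 * pi\<^sup>2 * (((partial 1 u x)\<^sup>2 + (partial 2 u x)\<^sup>2) / (2 * pi\<^sup>2) - 2 * (u x)\<^sup>2)) =
     (\<lambda>x. ((partial 1 u x)\<^sup>2 + (partial 2 u x)\<^sup>2) - 4 * pi\<^sup>2 * (u x)\<^sup>2)"
    by (simp add: fun_eq_iff right_diff_distrib)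
  also have "integral (cbox 0 1) \<dots> = integral (cbox 0 1) (\<lambda>x. (partial 1 u x)\<^sup>2 + (partial 2 u x)\<^sup>2)
      - integral (cbox 0 1) (\<lambda>x. 4 * pi\<^sup>2 * (u x)\<^sup>2)"
    by (intro Henstock_Kurzweil_Integration.integral_diff integrable_continuous continuous_intros)
  finally show ?thesis by simp
qed

lemma stable_cmc_clifford: "stable_cmc conf_metric clifford clifford_normal"
  unfolding stable_cmc_def
proof (intro conjI ballI impI)
  show "cmc conf_metric clifford clifford_normal"
    using minimal_clifford unfolding minimal_def cmc_def by blast
  fix u assume "u \<in> torus_functions" and 0: "area_integral conf_metric clifford u = 0"
  then have u: "smooth_on UNIV u" "doubly_periodic u" by (simp_all add: torus_functions_def)
  from 0 have "integral (cbox 0 1) u = 0" by (simp add: area_integral_clifford)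
  then show "stability_form conf_metric clifford clifford_normal u \<ge> 0"
    using wirtinger_torus[of u] smooth_on_differentiable[OF u(1)] smooth_on_continuous[OF smooth_on_partial[OF u(1)]] u
    by (simp add: stability_form_clifford)
qed

text \<open>In flat coordinates the Laplace eigenvalue is 2 pi^2 (2 + \<mu>), which lies below 4
  pi^2 precisely when \<mu> < 0. Eigenfunctions are therefore constant, and for a constant m the
  equation reads (2 + \<mu>) m = 0.\<close>

lemma eigenspace_clifford:
  assumes "\<mu> < 0"
  shows "eigenspace conf_metric clifford clifford_normal \<mu> =
    (if \<mu> = - 2 then range (\<lambda>m x. m) else {\<lambda>x. 0})"
proof -
  have jacobi: "jacobi_operator conf_metric clifford clifford_normal u x + \<mu> * u x =
    ((\<Sum>i\<in>UNIV. partial i (partial i u) x) + 2 * pi\<^sup>2 * (2 + \<mu>) * u x) / (2 * pi\<^sup>2)" for u x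
    unfolding jacobi_operator_def laplace_beltrami_clifford jacobi_potential_clifford by (simp add: field_simps)
  have const: "partial i (\<lambda>x. m) = (\<lambda>x. 0)" for i :: 2 and m :: real
    by (simp add: partial_def fun_eq_iff frechet_derivative_const)
  have constant_in: "(\<lambda>x. m) \<in> eigenspace conf_metric clifford clifford_normal \<mu> \<longleftrightarrow> \<mu> = - 2 \<or> m = 0" for m
    by (auto simp: eigenspace_def torus_functions_def smooth_on_const doubly_periodic_def jacobi const)
  have is_const: "\<exists>m. u = (\<lambda>x. m)"
    if "u \<in> eigenspace conf_metric clifford clifford_normal \<mu>" for u
  proof (rule torus_eigenfunction_constant)
    show "smooth_on UNIV u" "doubly_periodic u" using that by (simp_all add: eigenspace_def torus_functions_def)
    show "(\<Sum>i\<in>UNIV. partial i (partial i u) x) = - (2 * pi\<^sup>2 * (2 + \<mu>)) * u x" for x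
      using that by (simp add: eigenspace_def jacobi eq_neg_iff_add_eq_0)
    show "2 * pi\<^sup>2 * (2 + \<mu>) < 4 * pi\<^sup>2" using assms by (simp add: distrib_left mult_pos_neg)
  qed
  show ?thesis
  proof (intro equalityI subsetI)
    fix u assume u: "u \<in> eigenspace conf_metric clifford clifford_normal \<mu>"
    then obtain m where m: "u = (\<lambda>x. m)" using is_const by blast
    with u have "\<mu> = - 2 \<or> m = 0" by (simp only: constant_in)
    then show "u \<in> (if \<mu> = - 2 then range (\<lambda>m x. m) else {\<lambda>x. 0})" by (auto simp: m)
  next
    fix u :: "real^2 \<Rightarrow> real" assume "u \<in> (if \<mu> = - 2 then range (\<lambda>m x. m) else {\<lambda>x. 0})"
    then obtain m where "u = (\<lambda>x. m)" "\<mu> = - 2 \<or> m = 0" by (auto split: if_splits)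
    then show "u \<in> eigenspace conf_metric clifford clifford_normal \<mu>"
      by (simp only: constant_in)
  qed
qed

lemma has_index_clifford: "has_index conf_metric clifford clifford_normal 1"
proof -
  let ?E = "eigenspace conf_metric clifford clifford_normal"
  have "\<mu> \<in> negative_eigenvalues conf_metric clifford clifford_normal \<longleftrightarrow> \<mu> = - 2" for \<mu>
    by (auto simp: negative_eigenvalues_def eigenspace_clifford split: if_splits intro: exI[of _ 1])
  then have neg: "negative_eigenvalues conf_metric clifford clifford_normal = {- 2}"
    by blast
  have E: "?E (- 2) = range (\<lambda>m x. m)" by (simp add: eigenspace_clifford)
  have span: "?E (- 2) = fun_space.span {\<lambda>x. 1}"
    unfolding E fun_space.span_singleton by simp
  moreover have "fun_space.dim (fun_space.span {\<lambda>x::real^2. 1}) = 1"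
    by (subst fun_space.dim_span_eq_card_independent) (auto simp: fun_space.dependent_single fun_eq_iff)
  ultimately show ?thesis
    unfolding has_index_def neg by (auto intro: exI[of _ "{\<lambda>x. 1}"])
qed

theorem mainTheorem3:
  shows "\<exists>\<phi> :: real^4 \<Rightarrow> real.
           smooth_on_S3 \<phi> \<and>
           nonneg_Ricci (conformal \<phi> round_metric) \<and>
           (\<exists>T F N. torus_embedding F T \<and>
                    unit_normal (conformal \<phi> round_metric) F N \<and>
                    minimal (conformal \<phi> round_metric) F N \<and>
                    has_index (conformal \<phi> round_metric) F N 1 \<and>
                    stable_cmc (conformal \<phi> round_metric) F N)"
proof (intro exI conjI)
  show "smooth_on_S3 conformal_exponent" by (rule smooth_on_S3_conformal_exponent)
  show "nonneg_Ricci conf_metric" by (rule nonneg_Ricci_conformal_exponent)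
  show "torus_embedding clifford (range clifford)" by (rule torus_embedding_clifford)
  show "unit_normal conf_metric clifford clifford_normal" by (rule unit_normal_clifford)
  show "minimal conf_metric clifford clifford_normal" by (rule minimal_clifford)
  show "has_index conf_metric clifford clifford_normal 1" by (rule has_index_clifford)
  show "stable_cmc conf_metric clifford clifford_normal" by (rule stable_cmc_clifford)
qed

end
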